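(* Let $m,n$ be natural numbers and let $p\in[1,+\infty)$ be a real number. Assume that a sequence $\{u_i\}_{i=1}^{+\infty}$ converges weakly in $(L_\mu^p({\bf R}^n))^m$ to $u$. Then this sequence contains a subsequence $\{u_{i_r}\}_{r=1}^{+\infty}$ whose arithmetic means $\frac{1}{k}\sum_{r=1}^k u_{i_r}$ converge strongly in $(L_\mu^p({\bf R}^n))^m$ to $u$ as $k\to\infty$.
   Context: $\mu$ is the (nonnegative) Lebesgue measure on ${\bf R}^n$. For $p\in[1,+\infty)$, $L_\mu^p({\bf R}^n)$ is the Banach space of real-valued measurable functions $\hat u$ on ${\bf R}^n$ with finite norm $\|\hat u\|_p=\left(\int_{{\bf R}^n}|\hat u(x)|^p\,d\mu\right)^{1/p}$. $(L_\mu^p({\bf R}^n))^m$ is the Banach space of vector-valued functions $u=(\hat u^{(1)},\dots,\hat u^{(m)})$ with all components in $L_\mu^p({\bf R}^n)$, with norm $\|u\|_p=\left(\sum_{j=1}^m\|\hat u^{(j)}\|_p^p\right)^{1/p}$. A sequence $\{u_i\}$ converges strongly in $(L_\mu^p({\bf R}^n))^m$ to $u$ if $\lim_{i\to\infty}\|u_i-u\|_p=0$. Let $q=p/(p-1)$ if $p\in(1,+\infty)$ and $q=\infty$ if $p=1$. A sequence $\{\hat u_i\}$ in $L_\mu^p({\bf R}^n)$ converges weakly to $\hat u\in L_\mu^p({\bf R}^n)$ if $\lim_{i\to\infty}\int_{{\bf R}^n}\hat u_i\hat v\,d\mu=\int_{{\bf R}^n}\hat u\hat v\,d\mu$ for all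 $\hat v\in L_\mu^q({\bf R}^n)$. A sequence $u_i=(\hat u_i^{(1)},\dots,\hat u_i^{(m)})$ converges weakly in $(L_\mu^p({\bf R}^n))^m$ to $u=(\hat u^{(1)},\dots,\hat u^{(m)})$ if, for each $j=1,\dots,m$, $\hat u_i^{(j)}$ converges weakly in $L_\mu^p({\bf R}^n)$ to $\hat u^{(j)}$ as $i\to\infty$. *)

theory Defs
  imports "HOL-Analysis.Analysis"
begin

text \<open>Elements of the Lebesgue spaces are represented by functions, not by classes of functions
  modulo equality almost everywhere; all notions below are invariant under that equality.\<close>

definition Lp :: "real \<Rightarrow> (real ^ 'n \<Rightarrow> real) set" where
  "Lp p = {f \<in> borel_measurable lebesgue. integrable lebesgue (\<lambda>x. \<bar>f x\<bar> powr p)}"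

definition Linf :: "(real ^ 'n \<Rightarrow> real) set" where
  "Linf = {f \<in> borel_measurable lebesgue. \<exists>C. AE x in lebesgue. \<bar>f x\<bar> \<le> C}"

definition Lp_conj :: "real \<Rightarrow> (real ^ 'n \<Rightarrow> real) set" where
  "Lp_conj p = (if p = 1 then Linf else Lp (p / (p - 1)))"

definition Lp_norm :: "real \<Rightarrow> (real ^ 'n \<Rightarrow> real) \<Rightarrow> real" where
  "Lp_norm p f = (\<integral>x. \<bar>f x\<bar> powr p \<partial>lebesgue) powr (1 / p)"

definition Lp_vec :: "real \<Rightarrow> (real ^ 'n \<Rightarrow> real ^ 'm) set" where
  "Lp_vec p = {u. \<forall>j. (\<lambda>x. u x $ j) \<in> Lp p}"

definition Lp_vec_norm :: "real \<Rightarrow> (real ^ 'n \<Rightarrow> real ^ 'm) \<Rightarrow> real" where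
  "Lp_vec_norm p u = (\<Sum>j\<in>UNIV. Lp_norm p (\<lambda>x. u x $ j) powr p) powr (1 / p)"

definition strongly_convergent_Lp_vec ::
    "real \<Rightarrow> (nat \<Rightarrow> real ^ 'n \<Rightarrow> real ^ 'm) \<Rightarrow> (real ^ 'n \<Rightarrow> real ^ 'm) \<Rightarrow> bool" where
  "strongly_convergent_Lp_vec p u v \<longleftrightarrow>
     (\<forall>i. u i \<in> Lp_vec p) \<and> v \<in> Lp_vec p \<and>
     (\<lambda>i. Lp_vec_norm p (\<lambda>x. u i x - v x)) \<longlonglongrightarrow> 0"

definition weakly_convergent_Lp ::
    "real \<Rightarrow> (nat \<Rightarrow> real ^ 'n \<Rightarrow> real) \<Rightarrow> (real ^ 'n \<Rightarrow> real) \<Rightarrow> bool" where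
  "weakly_convergent_Lp p f g \<longleftrightarrow>
     (\<forall>i. f i \<in> Lp p) \<and> g \<in> Lp p \<and>
     (\<forall>v \<in> Lp_conj p.
        (\<lambda>i. \<integral>x. f i x * v x \<partial>lebesgue) \<longlonglongrightarrow> (\<integral>x. g x * v x \<partial>lebesgue))"

definition weakly_convergent_Lp_vec ::
    "real \<Rightarrow> (nat \<Rightarrow> real ^ 'n \<Rightarrow> real ^ 'm) \<Rightarrow> (real ^ 'n \<Rightarrow> real ^ 'm) \<Rightarrow> bool" where
  "weakly_convergent_Lp_vec p u v \<longleftrightarrow>
     (\<forall>j. weakly_convergent_Lp p (\<lambda>i x. u i x $ j) (\<lambda>x. v x $ j))"

end

theory Submission
  imports Defs
begin

text \<open>
  Subtracting the weak limit, let \<open>w i\<close> be weakly null and let \<open>S k\<close> be the sum of the first \<open>k\<close>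
  members of a subsequence that is still to be chosen. The subsequence is built one index at a time:
  when \<open>S k\<close> is known, it is a fixed function, so that finitely many pairings of later \<open>w n\<close> with
  bounded or conjugate-integrable functions of \<open>S k\<close> are as small as desired for all large \<open>n\<close>. The
  pairing to make small is the first-order term in the growth of a convex potential, and the
  remainder is then so small that the potential of \<open>S k\<close> grows more slowly than its trivial bound.

  For \<open>p > 1\<close> (Banach and Saks) the potential is \<open>\<bar>t\<bar> powr p\<close>. Its second-order remainder at \<open>a\<close> in
  direction \<open>b\<close> is at most \<open>\<eta> * \<bar>a\<bar> powr (p - 1) * \<bar>b\<bar> + D * \<bar>b\<bar> powr p\<close> with \<open>\<eta>\<close> arbitrarily small
  (\<open>abs_powr_increment\<close>). Since \<open>S k / k\<close> stays bounded in norm, the \<open>p\<close>-th power of the norm of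
  \<open>S k\<close> is at most \<open>B * k + e * k powr p\<close>, which is \<open>o (k powr p)\<close> because \<open>p > 1\<close>.

  For \<open>p = 1\<close> (Szlenk) the potential is \<open>sqrt (t\<^sup>2 + (K * h x)\<^sup>2)\<close>, with \<open>h\<close> a fixed positive
  integrable function. It differs from \<open>\<bar>t\<bar>\<close> by at most \<open>K * h\<close>, has slope at most \<open>1\<close>, and its
  remainder is at most \<open>b\<^sup>2 / (2 * K * h)\<close> as well as \<open>2 * \<bar>b\<bar>\<close>. The integrals of these remainders are
  uniformly small for large \<open>K\<close> provided that the part of \<open>w i\<close> where \<open>\<bar>w i\<bar> > N * h\<close> has uniformly
  small integral; the weight \<open>h\<close> makes this one condition express both uniform integrability
  and tightness.

  Weak convergence has to supply norm bounds and this uniform integrability. Both come from one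
  gliding hump argument in \<open>L\<^sup>1\<close> (\<open>gliding_hump\<close>): were they to fail, a single function bounded by
  \<open>1\<close> could be assembled whose pairings with a subsequence stay away from \<open>0\<close>. The norm bound for
  \<open>p > 1\<close> follows from that for \<open>p = 1\<close>, because products with a fixed conjugate-integrable
  function are weakly null in \<open>L\<^sup>1\<close>.

  Whether an index is admissible depends only on the indices chosen before it and holds for all large
  indices. Such requirements for the finitely many components can therefore be imposed together.
\<close>

section \<open>Choosing subsequences step by step\<close>

text \<open>The requirement on the next index may depend on the whole list of previous indices. Keeping it
in the form of a predicate, instead of fixing one subsequence, allows the requirements of several
sequences to be combined by conjunction.\<close>

lemma ex_strict_mono_history:
  fixes Q :: "nat list \<Rightarrow> nat \<Rightarrow> bool"
  assumes "\<And>l. eventually (Q l) sequentially"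
  shows "\<exists>s. strict_mono s \<and> (\<forall>k. Q (map s [0..<k]) (s k))"
proof -
  have "\<exists>n. Q l n \<and> (\<forall>m\<in>set l. m < n)" for l
  proof -
    have "eventually (\<lambda>n. \<forall>m\<in>set l. m < n) sequentially"
      by (intro eventually_ball_finite ballI eventually_gt_at_top) auto
    with assms[of l] have "eventually (\<lambda>n. Q l n \<and> (\<forall>m\<in>set l. m < n)) sequentially"
      by (rule eventually_conj)
    then show ?thesis by (auto simp: eventually_sequentially)
  qed
  then obtain pick where pick: "\<And>l. Q l (pick l)" "\<And>l m. m \<in> set l \<Longrightarrow> m < pick l"
    by metis
  define hist where "hist = rec_nat [] (\<lambda>_ l. l @ [pick l])"
  have hist_simps: "hist 0 = []" "\<And>k. hist (Suc k) = hist k @ [pick (hist k)]"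
    by (auto simp: hist_def)
  define s where "s k = pick (hist k)" for k
  have hist_eq: "hist k = map s [0..<k]" for k
    by (induction k) (auto simp: hist_simps s_def)
  have "strict_mono s"
  proof (rule strict_monoI)
    fix i k :: nat assume "i < k"
    then have "s i \<in> set (hist k)" by (auto simp: hist_eq)
    then show "s i < s k" unfolding s_def[of k] by (rule pick(2))
  qed
  moreover have "Q (map s [0..<k]) (s k)" for k
    using pick(1)[of "hist k"] by (simp add: hist_eq s_def)
  ultimately show ?thesis by blast
qed

text \<open>Turns the failure of a uniform bound into a sequence of counterexamples whose indices tend to
infinity, so that it inherits weak convergence to zero.\<close>

lemma escaping_witnesses:
  fixes P :: "nat \<Rightarrow> nat \<Rightarrow> bool"
  assumes ex: "\<And>k. \<exists>i. P k i" and lost: "\<And>i. eventually (\<lambda>k. \<not> P k i) sequentially"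
  shows "\<exists>i. filterlim i at_top sequentially \<and> (\<forall>k. P k (i k))"
proof -
  from ex obtain i where i: "\<And>k. P k (i k)" by metis
  have "eventually (\<lambda>k. n \<le> i k) sequentially" for n
  proof -
    have "eventually (\<lambda>k. \<forall>m\<in>{..<n}. \<not> P k m) sequentially"
      using lost by (intro eventually_ball_finite) auto
    then show ?thesis by eventually_elim (metis i lessThan_iff not_le)
  qed
  then show ?thesis using i by (auto simp: filterlim_at_top)
qed

section \<open>Weakly null sequences of integrable functions\<close>

lemma nonneg_series_integrable:
  fixes f :: "nat \<Rightarrow> 'a \<Rightarrow> real"
  assumes int: "\<And>k. integrable M (f k)" and nonneg: "\<And>k x. 0 \<le> f k x"
    and sum: "summable (\<lambda>k. \<integral>x. f k x \<partial>M)"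
  shows "AE x in M. summable (\<lambda>k. f k x)" and "integrable M (\<lambda>x. \<Sum>k. f k x)"
proof -
  have [measurable]: "f k \<in> borel_measurable M" for k
    using int by auto
  have "(\<integral>\<^sup>+x. (\<Sum>k. ennreal (f k x)) \<partial>M) = (\<Sum>k. \<integral>\<^sup>+x. ennreal (f k x) \<partial>M)"
    by (rule nn_integral_suminf) measurable
  also have "\<dots> = (\<Sum>k. ennreal (\<integral>x. f k x \<partial>M))"
    using int nonneg by (intro suminf_cong nn_integral_eq_integral) auto
  also have "\<dots> \<noteq> \<infinity>"
    using sum nonneg by (simp add: suminf_ennreal2)
  finally have "AE x in M. (\<Sum>k. ennreal (f k x)) \<noteq> \<infinity>"
    by (intro nn_integral_PInf_AE) auto
  then show *: "AE x in M. summable (\<lambda>k. f k x)"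
    by eventually_elim (intro summable_suminf_not_top, auto simp: nonneg)
  show "integrable M (\<lambda>x. \<Sum>k. f k x)"
    using int * sum nonneg by (intro integrable_suminf) auto
qed

definition L1_weakly_null :: "'a measure \<Rightarrow> (nat \<Rightarrow> 'a \<Rightarrow> real) \<Rightarrow> bool" where
  "L1_weakly_null M w \<longleftrightarrow> (\<forall>i. integrable M (w i)) \<and>
     (\<forall>g\<in>borel_measurable M. (\<forall>x. \<bar>g x\<bar> \<le> 1) \<longrightarrow> (\<lambda>i. \<integral>x. w i x * g x \<partial>M) \<longlonglongrightarrow> 0)"

lemma L1_weakly_null_compose:
  assumes "L1_weakly_null M w" and "filterlim i at_top sequentially"
  shows "L1_weakly_null M (\<lambda>k. w (i k))"
  using assms unfolding L1_weakly_null_def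
  by (auto intro: filterlim_compose[of "\<lambda>i. \<integral>x. w i x * _ x \<partial>M", OF _ assms(2)])

lemma integrable_mult_bounded:
  fixes f g :: "'a \<Rightarrow> real"
  assumes "integrable M f" "g \<in> borel_measurable M" "\<And>x. \<bar>g x\<bar> \<le> B"
  shows "integrable M (\<lambda>x. f x * g x)"
proof (rule Bochner_Integration.integrable_bound)
  show "integrable M (\<lambda>x. B * f x)" using assms by auto
  show "(\<lambda>x. f x * g x) \<in> borel_measurable M" using assms by auto
  have "\<bar>f x * g x\<bar> \<le> \<bar>B * f x\<bar>" for x
  proof -
    have "\<bar>g x\<bar> \<le> \<bar>B\<bar>" using assms(3)[of x] by linarith
    then show ?thesis
      using mult_right_mono[of "\<bar>g x\<bar>" "\<bar>B\<bar>" "\<bar>f x\<bar>"] by (simp add: abs_mult mult.commute)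
  qed
  then show "AE x in M. norm (f x * g x) \<le> norm (B * f x)" by auto
qed

text \<open>A bounded test function is built in stages. Stage \<open>k\<close> replaces the current function \<open>x\<close> by the
convex combination \<open>(1 - b k) * x + b k * (+- sgn (w k))\<close>, which keeps it bounded by \<open>1\<close>. The two
choices of sign change the pairing with \<open>w k\<close> by opposite amounts, each the integral of
\<open>b k * \<bar>w k\<bar>\<close>, so one choice makes the pairing at least that large in absolute value, whatever the
earlier stages did. The geometric decay of the later humps on \<open>w k\<close> ensures that later stages
destroy at most half of it. Pairing the limit function with \<open>w k\<close> then gives the conclusion.

Constant \<open>b k\<close> yields norm bounds, and indicator functions yield uniform integrability.\<close>

lemma gliding_hump:
  fixes w b :: "nat \<Rightarrow> 'a \<Rightarrow> real"
  assumes null: "L1_weakly_null M w"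
    and b_meas [measurable]: "\<And>k. b k \<in> borel_measurable M"
    and b: "\<And>k x. 0 \<le> b k x" "\<And>k x. b k x \<le> 1"
    and tail: "\<And>k j. k < j \<Longrightarrow>
      (\<integral>x. b j x * \<bar>w k x\<bar> \<partial>M) \<le> (1/8) ^ (j - k) * (\<integral>x. b k x * \<bar>w k x\<bar> \<partial>M)"
  shows "(\<lambda>k. \<integral>x. b k x * \<bar>w k x\<bar> \<partial>M) \<longlonglongrightarrow> 0"
proof -
  have int_w: "integrable M (w k)" for k
    using null by (auto simp: L1_weakly_null_def)
  then have [measurable]: "w k \<in> borel_measurable M" for k by auto
  define \<beta> where "\<beta> k = (\<integral>x. b k x * \<bar>w k x\<bar> \<partial>M)" for k
  define y where "y k x = (\<lambda>t. (1 - b k t) * x t)" for k x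
  define step where "step k x =
    (if 0 \<le> (\<integral>t. w k t * y k x t \<partial>M) then (\<lambda>t. y k x t + b k t * sgn (w k t))
     else (\<lambda>t. y k x t - b k t * sgn (w k t)))" for k x
  define x where "x = rec_nat (\<lambda>_. 0) step"
  have x_simps: "x 0 = (\<lambda>_. 0)" "\<And>k. x (Suc k) = step k (x k)"
    by (auto simp: x_def)
  have x_meas [measurable]: "x k \<in> borel_measurable M" for k
  proof (induction k)
    case (Suc k)
    note Suc[measurable]
    have "step k (x k) \<in> borel_measurable M"
      unfolding step_def y_def
      by (cases "0 \<le> (\<integral>t. w k t * ((1 - b k t) * x k t) \<partial>M)") (simp_all, measurable)
    then show ?case by (simp add: x_simps)
  qed (simp add: x_simps)
  have y_bound: "\<bar>y k z t + b k t * e\<bar> \<le> 1" if "\<bar>z t\<bar> \<le> 1" "\<bar>e\<bar> \<le> 1" for k z t e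
  proof -
    have "\<bar>y k z t + b k t * e\<bar> \<le> (1 - b k t) * \<bar>z t\<bar> + b k t * \<bar>e\<bar>"
      unfolding y_def using b[where k=k and x=t] by (intro order_trans[OF abs_triangle_ineq]) (simp add: abs_mult)
    also have "\<dots> \<le> (1 - b k t) * 1 + b k t * 1"
      using b[where k=k and x=t] that by (intro add_mono mult_left_mono) auto
    finally show ?thesis by simp
  qed
  have sgn_le: "\<bar>sgn r\<bar> \<le> 1" "\<bar>- sgn r\<bar> \<le> 1" for r :: real by (auto simp: sgn_if)
  have x_bound: "\<bar>x k t\<bar> \<le> 1" for k t
  proof (induction k)
    case (Suc k)
    show ?case
      using y_bound[of "x k" t "sgn (w k t)" k, OF Suc sgn_le(1)]
        y_bound[of "x k" t "- sgn (w k t)" k, OF Suc sgn_le(2)]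
      by (auto simp: x_simps step_def)
  qed (simp add: x_simps)
  have x_step: "\<bar>x (Suc k) t - x k t\<bar> \<le> 2 * b k t" for k t
  proof -
    have *: "\<bar>y k (x k) t + b k t * e - x k t\<bar> \<le> 2 * b k t" if "\<bar>e\<bar> \<le> 1" for e
    proof -
      have "y k (x k) t + b k t * e - x k t = b k t * (e - x k t)"
        by (simp add: y_def algebra_simps)
      then have "\<bar>y k (x k) t + b k t * e - x k t\<bar> = b k t * \<bar>e - x k t\<bar>"
        using b(1)[of k t] by (simp add: abs_mult)
      also have "\<dots> \<le> b k t * 2"
        using b(1)[of k t] x_bound[of k t] that by (intro mult_left_mono) auto
      finally show ?thesis by simp
    qed
    show ?thesis
      using *[OF sgn_le(1), of "w k t"] *[OF sgn_le(2), of "w k t"]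
      by (auto simp: x_simps step_def)
  qed
  define T where "T k z = (\<integral>t. w k t * z t \<partial>M)" for k and z :: "'a \<Rightarrow> real"
  have int_wx: "integrable M (\<lambda>t. w k t * x j t)" for k j
    by (intro integrable_mult_bounded[where B=1] int_w x_bound) auto
  have int_wb: "integrable M (\<lambda>t. b j t * \<bar>w k t\<bar>)" for j k
    using integrable_mult_bounded[where B=1, OF integrable_abs[OF int_w[of k]], of "b j"] b
    by (simp add: mult.commute)
  have T_gain: "\<beta> k \<le> \<bar>T k (x (Suc k))\<bar>" for k
  proof -
    have int_y: "integrable M (\<lambda>t. w k t * y k (x k) t)"
      using y_bound[of "x k" _ 0 k, OF x_bound]
      by (intro integrable_mult_bounded[where B=1] int_w) (auto simp: y_def)
    have "w k t * (y k (x k) t + b k t * sgn (w k t)) = w k t * y k (x k) t + b k t * \<bar>w k t\<bar>"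
         "w k t * (y k (x k) t - b k t * sgn (w k t)) = w k t * y k (x k) t - b k t * \<bar>w k t\<bar>" for t
      by (auto simp: sgn_if algebra_simps abs_if)
    then have "T k (x (Suc k)) = (if 0 \<le> T k (y k (x k)) then T k (y k (x k)) + \<beta> k else T k (y k (x k)) - \<beta> k)"
      using int_y int_wb[of k k] by (simp add: T_def x_simps step_def \<beta>_def)
    moreover have "0 \<le> \<beta> k" using b by (simp add: \<beta>_def)
    ultimately show ?thesis by auto
  qed
  have T_step: "\<bar>T k (x (Suc l)) - T k (x l)\<bar> \<le> 2 * (\<integral>t. b l t * \<bar>w k t\<bar> \<partial>M)" for k l
  proof -
    have "T k (x (Suc l)) - T k (x l) = (\<integral>t. w k t * (x (Suc l) t - x l t) \<partial>M)"
      using int_wx by (simp add: T_def algebra_simps)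
    also have "\<bar>\<dots>\<bar> \<le> (\<integral>t. \<bar>w k t * (x (Suc l) t - x l t)\<bar> \<partial>M)"
      by (rule integral_abs_bound)
    also have "\<dots> \<le> (\<integral>t. 2 * (b l t * \<bar>w k t\<bar>) \<partial>M)"
    proof (rule integral_mono)
      show "integrable M (\<lambda>t. \<bar>w k t * (x (Suc l) t - x l t)\<bar>)"
        using int_wx[of k "Suc l"] int_wx[of k l] by (simp add: right_diff_distrib)
      show "integrable M (\<lambda>t. 2 * (b l t * \<bar>w k t\<bar>))" using int_wb by simp
      fix t show "\<bar>w k t * (x (Suc l) t - x l t)\<bar> \<le> 2 * (b l t * \<bar>w k t\<bar>)"
        using mult_left_mono[OF x_step[of l t], of "\<bar>w k t\<bar>"] by (simp add: abs_mult mult_ac)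
    qed
    finally show ?thesis by simp
  qed
  have \<beta>_nonneg: "0 \<le> \<beta> k" for k using b by (simp add: \<beta>_def)
  have T_keep: "\<bar>T k (x (Suc k + n)) - T k (x (Suc k))\<bar> \<le> \<beta> k / 2 * (1 - (1/8) ^ n)" for k n
  proof (induction n)
    case (Suc n)
    have "\<bar>T k (x (Suc (Suc k + n))) - T k (x (Suc k + n))\<bar> \<le> 2 * ((1/8) ^ Suc n * \<beta> k)"
      using T_step[of k "Suc k + n"] tail[of k "Suc k + n"] by (simp add: \<beta>_def)
    with Suc have "\<bar>T k (x (Suc (Suc k + n))) - T k (x (Suc k))\<bar>
        \<le> \<beta> k / 2 * (1 - (1/8) ^ n) + 2 * ((1/8) ^ Suc n * \<beta> k)" by linarith
    also have "\<dots> = \<beta> k / 2 * (1 - (1/8) ^ Suc n) - 3/16 * ((1/8) ^ n * \<beta> k)"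
      by (simp add: algebra_simps)
    also have "\<dots> \<le> \<beta> k / 2 * (1 - (1/8) ^ Suc n)" using \<beta>_nonneg[of k] by simp
    finally show ?case by (simp add: add.commute)
  qed simp
  \<comment> \<open>On the set where some \<open>w k\<close> is nonzero the stages converge almost everywhere; elsewhere the value is immaterial.\<close>
  define z where "z t = (if convergent (\<lambda>k. x k t) then lim (\<lambda>k. x k t) else 0)" for t
  have z_meas [measurable]: "z \<in> borel_measurable M" 
    unfolding z_def Cauchy_convergent_iff[symmetric] by measurable
  have z_lim: "(\<lambda>k. x k t) \<longlonglongrightarrow> z t" if "convergent (\<lambda>k. x k t)" for t
    using that by (simp add: z_def convergent_LIMSEQ_iff)
  have z_bound: "\<bar>z t\<bar> \<le> 1" for t
  proof (cases "convergent (\<lambda>k. x k t)")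
    case True
    from tendsto_rabs[OF z_lim[OF this]] show ?thesis
      by (rule LIMSEQ_le_const2) (auto simp: x_bound)
  qed (simp add: z_def)
  have T_lim: "(\<lambda>j. T k (x j)) \<longlonglongrightarrow> T k z" for k
    unfolding T_def
  proof (rule integral_dominated_convergence)
    show "integrable M (\<lambda>t. \<bar>w k t\<bar>)" using int_w by simp
    show "AE t in M. norm (w k t * x j t) \<le> \<bar>w k t\<bar>" for j
      using mult_left_mono[OF x_bound, of "\<bar>w k _\<bar>"] by (simp add: abs_mult)
    have "summable (\<lambda>j. \<integral>t. b (j + Suc k) t * \<bar>w k t\<bar> \<partial>M)"
    proof (rule summable_comparison_test')
      show "summable (\<lambda>j. (1/8) ^ Suc j * \<beta> k)"
        by (intro summable_mult2 summable_ignore_initial_segment[of _ 1, simplified]) (auto simp: summable_geometric)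
      show "norm (\<integral>t. b (j + Suc k) t * \<bar>w k t\<bar> \<partial>M) \<le> (1/8) ^ Suc j * \<beta> k" if "0 \<le> j" for j
        using tail[of k "j + Suc k"] b by (simp add: \<beta>_def)
    qed
    then have "AE t in M. summable (\<lambda>j. b (j + Suc k) t * \<bar>w k t\<bar>)"
      using int_wb b by (intro nonneg_series_integrable(1)) auto
    then show "AE t in M. (\<lambda>j. w k t * x j t) \<longlonglongrightarrow> w k t * z t"
    proof eventually_elim
      case (elim t)
      show ?case
      proof (cases "w k t = 0")
        case False
        have "summable (\<lambda>j. b (j + Suc k) t * \<bar>w k t\<bar> * inverse \<bar>w k t\<bar>)"
          using elim by (rule summable_mult2)
        then have "summable (\<lambda>j. b (j + Suc k) t)" using False by (simp add: mult.assoc)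
        then have "summable (\<lambda>j. 2 * b j t)" by (subst (asm) summable_iff_shift) (rule summable_mult)
        then have "summable (\<lambda>j. x (Suc j) t - x j t)"
          by (rule summable_comparison_test'[of _ 0]) (simp add: x_step)
        then have "convergent (\<lambda>j. \<Sum>i<j. x (Suc i) t - x i t)"
          by (simp add: summable_iff_convergent)
        then have "convergent (\<lambda>j. x j t)"
          by (simp add: sum_lessThan_telescope[of "\<lambda>j. x j t"] x_simps(1))
        then show ?thesis by (intro tendsto_mult z_lim) auto
      qed auto
    qed
  qed auto
  have "\<beta> k / 2 \<le> \<bar>T k z\<bar>" for k
  proof -
    have "(\<lambda>n. T k (x (Suc k + n))) \<longlonglongrightarrow> T k z"
      using LIMSEQ_ignore_initial_segment[OF T_lim, of k "Suc k"] by (simp add: add.commute)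
    then have "(\<lambda>n. \<bar>T k (x (Suc k + n)) - T k (x (Suc k))\<bar>) \<longlonglongrightarrow> \<bar>T k z - T k (x (Suc k))\<bar>"
      by (intro tendsto_intros)
    then have "\<bar>T k z - T k (x (Suc k))\<bar> \<le> \<beta> k / 2"
    proof (rule LIMSEQ_le_const2)
      have "\<bar>T k (x (Suc k + n)) - T k (x (Suc k))\<bar> \<le> \<beta> k / 2" for n
        using T_keep[of k n] \<beta>_nonneg[of k] mult_left_mono[of "1 - (1/8) ^ n" 1 "\<beta> k / 2"] by force
      then show "\<exists>N. \<forall>n\<ge>N. \<bar>T k (x (Suc k + n)) - T k (x (Suc k))\<bar> \<le> \<beta> k / 2" by blast
    qed
    with T_gain[of k] show ?thesis by linarith
  qed
  moreover have "(\<lambda>k. T k z) \<longlonglongrightarrow> 0"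
    using null z_bound z_meas unfolding L1_weakly_null_def T_def by blast
  ultimately have "(\<lambda>k. \<beta> k / 2) \<longlonglongrightarrow> 0"
    using \<beta>_nonneg by (intro Lim_null_comparison[of "\<lambda>k. \<beta> k / 2" "\<lambda>k. \<bar>T k z\<bar>"]) (auto intro: tendsto_rabs_zero)
  then have "(\<lambda>k. 2 * (\<beta> k / 2)) \<longlonglongrightarrow> 0" by (rule tendsto_mult_right_zero)
  then show ?thesis by (simp add: \<beta>_def)
qed

text \<open>If the norms were unbounded, a subsequence would satisfy \<open>8 ^ k < norm (w k)\<close>. The constants
\<open>(1/8) ^ k\<close> are then humps that meet the decay condition of \<open>gliding_hump\<close> with equality, although
their contributions stay above \<open>1\<close>.\<close>

lemma L1_weakly_null_bounded:
  assumes null: "L1_weakly_null M w"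
  shows "\<exists>C. \<forall>i. (\<integral>x. \<bar>w i x\<bar> \<partial>M) \<le> C"
proof (rule ccontr)
  assume "\<nexists>C. \<forall>i. (\<integral>x. \<bar>w i x\<bar> \<partial>M) \<le> C"
  then have ex: "\<exists>i. 8 ^ k < (\<integral>x. \<bar>w i x\<bar> \<partial>M)" for k :: nat
    by (meson not_le)
  have lost: "eventually (\<lambda>k. \<not> 8 ^ k < (\<integral>x. \<bar>w i x\<bar> \<partial>M)) sequentially" for i
  proof -
    obtain n where n: "(\<integral>x. \<bar>w i x\<bar> \<partial>M) < 8 ^ n"
      using real_arch_pow[of "8::real" "\<integral>x. \<bar>w i x\<bar> \<partial>M"] by auto
    have "\<not> 8 ^ k < (\<integral>x. \<bar>w i x\<bar> \<partial>M)" if "n \<le> k" for k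
    proof -
      have "(8::real) ^ n \<le> 8 ^ k" using that by (intro power_increasing) auto
      with n show ?thesis by linarith
    qed
    then show ?thesis by (auto simp: eventually_sequentially)
  qed
  from escaping_witnesses[OF ex lost] obtain i where i: "filterlim i at_top sequentially"
    "\<And>k. 8 ^ k < (\<integral>x. \<bar>w (i k) x\<bar> \<partial>M)" by blast
  have "(\<lambda>k. \<integral>x. (1/8) ^ k * \<bar>w (i k) x\<bar> \<partial>M) \<longlonglongrightarrow> 0"
  proof (rule gliding_hump[OF L1_weakly_null_compose[OF null i(1)]])
    fix k j :: nat assume "k < j"
    then have "(1/8::real) ^ j = (1/8) ^ (j - k) * (1/8) ^ k"
      by (simp flip: power_add)
    then show "(\<integral>x. (1/8) ^ j * \<bar>w (i k) x\<bar> \<partial>M)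
        \<le> (1/8) ^ (j - k) * (\<integral>x. (1/8) ^ k * \<bar>w (i k) x\<bar> \<partial>M)" by simp
  qed (auto simp: power_le_one)
  moreover have "1 \<le> (\<integral>x. (1/8) ^ k * \<bar>w (i k) x\<bar> \<partial>M)" for k
    using i(2)[of k] by (simp add: power_divide field_simps)
  ultimately have "1 \<le> (0::real)"
    by (intro LIMSEQ_le_const[of _ "0::real" 1]) auto
  then show False by simp
qed

text \<open>Real-valued, so that it can serve directly as a hump. The threshold is a multiple of a positive
function \<open>h\<close>, not a constant: for integrable \<open>h\<close>, smallness of the mass above the threshold
controls concentration and escape to infinity at the same time.\<close>

definition exceeds :: "('a \<Rightarrow> real) \<Rightarrow> nat \<Rightarrow> ('a \<Rightarrow> real) \<Rightarrow> 'a \<Rightarrow> real" where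
  "exceeds h N f x = (if real N * h x < \<bar>f x\<bar> then 1 else 0)"

lemma exceeds_simps [simp]: "0 \<le> exceeds h N f x" "exceeds h N f x \<le> 1" "\<bar>exceeds h N f x\<bar> \<le> 1"
  by (auto simp: exceeds_def)

lemma exceeds_measurable [measurable]:
  assumes [measurable]: "h \<in> borel_measurable M" "f \<in> borel_measurable M"
  shows "exceeds h N f \<in> borel_measurable M"
  unfolding exceeds_def by measurable

text \<open>The sets where \<open>\<bar>w i\<bar> > N * h\<close> have mass at most \<open>C / N\<close> for the measure with density \<open>h\<close>, uniformly
in \<open>i\<close>. So their effect on one fixed \<open>g\<close> is small: beyond \<open>L * h\<close> the function \<open>g\<close> has little
mass, and below it the integral of \<open>\<bar>g\<bar>\<close> is at most \<open>L * C / N\<close>.\<close>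

lemma single_integral_over_exceedance_small:
  fixes w :: "nat \<Rightarrow> 'a \<Rightarrow> real"
  assumes int_w: "\<And>i. integrable M (w i)" and C: "\<And>i. (\<integral>x. \<bar>w i x\<bar> \<partial>M) \<le> C"
    and h: "integrable M h" "\<And>x. 0 < h x" and g: "integrable M g" and "0 < \<eta>"
  shows "eventually (\<lambda>N. \<forall>i. (\<integral>x. exceeds h N (w i) x * \<bar>g x\<bar> \<partial>M) \<le> \<eta>) sequentially"
proof -
  have [measurable]: "w i \<in> borel_measurable M" "h \<in> borel_measurable M" "g \<in> borel_measurable M" for i
    using int_w h g by auto
  have int_e: "integrable M (\<lambda>x. exceeds h N f x * \<bar>u x\<bar>)"
    if "f \<in> borel_measurable M" "integrable M u" for N f u
    using integrable_mult_bounded[OF integrable_abs[OF that(2)], of "exceeds h N f" 1] that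
    by (simp add: mult.commute)
  have "(\<lambda>L. \<integral>x. exceeds h L g x * \<bar>g x\<bar> \<partial>M) \<longlonglongrightarrow> (\<integral>x. 0 \<partial>M)"
  proof (rule integral_dominated_convergence)
    show "integrable M (\<lambda>x. \<bar>g x\<bar>)" using g by simp
    show "AE x in M. norm (exceeds h L g x * \<bar>g x\<bar>) \<le> \<bar>g x\<bar>" for L
      by (simp add: exceeds_def)
    have "(\<lambda>L. exceeds h L g x * \<bar>g x\<bar>) \<longlonglongrightarrow> 0" for x
    proof (rule tendsto_eventually)
      have "eventually (\<lambda>L. \<bar>g x\<bar> / h x \<le> real L) sequentially"
        using filterlim_real_sequentially by (simp add: filterlim_at_top)
      then show "eventually (\<lambda>L. exceeds h L g x * \<bar>g x\<bar> = 0) sequentially"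
        by eventually_elim (use h(2)[of x] in \<open>simp add: exceeds_def pos_divide_le_eq\<close>)
    qed
    then show "AE x in M. (\<lambda>L. exceeds h L g x * \<bar>g x\<bar>) \<longlonglongrightarrow> 0" by simp
  qed auto
  then have "eventually (\<lambda>L. (\<integral>x. exceeds h L g x * \<bar>g x\<bar> \<partial>M) < \<eta> / 2) sequentially"
    using \<open>0 < \<eta>\<close> by (intro order_tendstoD(2)[where y=0]) auto
  then obtain L where L: "(\<integral>x. exceeds h L g x * \<bar>g x\<bar> \<partial>M) < \<eta> / 2"
    by (auto simp: eventually_sequentially)
  have "(\<lambda>N. real L * C / real N) \<longlonglongrightarrow> 0"
    by (intro tendsto_divide_0[OF tendsto_const] filterlim_at_top_imp_at_infinity filterlim_real_sequentially)
  then have "eventually (\<lambda>N. real L * C / real N < \<eta> / 2) sequentially"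
    using \<open>0 < \<eta>\<close> by (intro order_tendstoD(2)[where y=0]) auto
  then show ?thesis using eventually_gt_at_top[of 0]
  proof eventually_elim
    case (elim N)
    show ?case
    proof
      fix i
      have "(\<integral>x. exceeds h N (w i) x * \<bar>g x\<bar> \<partial>M)
          \<le> (\<integral>x. exceeds h L g x * \<bar>g x\<bar> + real L / real N * \<bar>w i x\<bar> \<partial>M)"
      proof (rule integral_mono)
        fix x
        show "exceeds h N (w i) x * \<bar>g x\<bar> \<le> exceeds h L g x * \<bar>g x\<bar> + real L / real N * \<bar>w i x\<bar>"
        proof (cases "real L * h x < \<bar>g x\<bar> \<or> \<bar>w i x\<bar> \<le> real N * h x")
          case False
          then have "h x * real N \<le> \<bar>w i x\<bar>" by (simp add: mult.commute)
          then have "h x \<le> \<bar>w i x\<bar> / real N"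
            using elim(2) by (simp add: pos_le_divide_eq)
          then have "real L * h x \<le> real L * (\<bar>w i x\<bar> / real N)"
            by (intro mult_left_mono) auto
          with False have "\<bar>g x\<bar> \<le> real L * (\<bar>w i x\<bar> / real N)" by linarith
          with False show ?thesis by (simp add: exceeds_def)
        qed (auto simp: exceeds_def)
      qed (use int_e g int_w in auto)
      also have "\<dots> = (\<integral>x. exceeds h L g x * \<bar>g x\<bar> \<partial>M) + real L / real N * (\<integral>x. \<bar>w i x\<bar> \<partial>M)"
        using int_e g int_w by simp
      also have "\<dots> \<le> \<eta> / 2 + real L / real N * C"
        using L C by (intro add_mono mult_left_mono) auto
      also have "\<dots> \<le> \<eta>" using elim(1) by (simp only: times_divide_eq_left)
      finally show "(\<integral>x. exceeds h N (w i) x * \<bar>g x\<bar> \<partial>M) \<le> \<eta>" .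
    qed
  qed
qed

text \<open>Otherwise some \<open>w (i N)\<close> has mass above \<open>\<epsilon>\<close> on the set where \<open>\<bar>w (i N)\<bar> > N * h\<close>, for every \<open>N\<close>. By
the preceding lemma these sets are eventually negligible for each fixed function; hence \<open>i N\<close> tends
to infinity and a sparse choice of \<open>N\<close> satisfies the decay condition of \<open>gliding_hump\<close>,
which contradicts the lower bound \<open>\<epsilon>\<close>.\<close>

lemma L1_weakly_null_equiintegrable:
  assumes null: "L1_weakly_null M w" and h: "integrable M h" "\<And>x. 0 < h x" and "0 < \<epsilon>"
  shows "\<exists>N. \<forall>i. (\<integral>x. exceeds h N (w i) x * \<bar>w i x\<bar> \<partial>M) \<le> \<epsilon>"
proof (rule ccontr)
  assume "\<not> ?thesis"
  then have ex: "\<exists>i. \<epsilon> < (\<integral>x. exceeds h N (w i) x * \<bar>w i x\<bar> \<partial>M)" for N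
    by (meson not_le)
  have int_w: "integrable M (w i)" for i using null by (simp add: L1_weakly_null_def)
  then have [measurable]: "w i \<in> borel_measurable M" "h \<in> borel_measurable M" for i using h by auto
  obtain C where C: "\<And>i. (\<integral>x. \<bar>w i x\<bar> \<partial>M) \<le> C" using L1_weakly_null_bounded[OF null] by blast
  note small = single_integral_over_exceedance_small[of M w C h, OF int_w C h]
  have lost: "eventually (\<lambda>N. \<not> \<epsilon> < (\<integral>x. exceeds h N (w i) x * \<bar>w i x\<bar> \<partial>M)) sequentially" for i
    using small[OF int_w[of i] \<open>0 < \<epsilon>\<close>] by eventually_elim (simp add: not_less)
  from escaping_witnesses[OF ex lost] obtain i where i: "filterlim i at_top sequentially"
    "\<And>N. \<epsilon> < (\<integral>x. exceeds h N (w (i N)) x * \<bar>w (i N) x\<bar> \<partial>M)" by blast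
  define Q where "Q l N \<longleftrightarrow>
    (\<forall>m\<in>set l. (\<integral>x. exceeds h N (w (i N)) x * \<bar>w (i m) x\<bar> \<partial>M) \<le> (1/8) ^ length l * \<epsilon>)" for l N
  have "eventually (Q l) sequentially" for l
    unfolding Q_def
  proof (intro eventually_ball_finite ballI)
    fix m
    have "0 < (1/8) ^ length l * \<epsilon>" using \<open>0 < \<epsilon>\<close> by simp
    from small[OF int_w[of "i m"] this]
    show "eventually (\<lambda>N. (\<integral>x. exceeds h N (w (i N)) x * \<bar>w (i m) x\<bar> \<partial>M) \<le> (1/8) ^ length l * \<epsilon>)
        sequentially"
      by (rule eventually_mono) (erule allE, assumption)
  qed simp
  from ex_strict_mono_history[of Q, OF this]
  obtain s where s: "strict_mono s" "\<And>k. Q (map s [0..<k]) (s k)" by blast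
  have "(\<lambda>k. \<integral>x. exceeds h (s k) (w (i (s k))) x * \<bar>w (i (s k)) x\<bar> \<partial>M) \<longlonglongrightarrow> 0"
  proof (rule gliding_hump[where w="\<lambda>k. w (i (s k))" and b="\<lambda>k. exceeds h (s k) (w (i (s k)))"])
    show "L1_weakly_null M (\<lambda>k. w (i (s k)))"
      by (rule L1_weakly_null_compose[OF null filterlim_compose[OF i(1) filterlim_subseq[OF s(1)]]])
    fix k j :: nat assume "k < j"
    then have "(\<integral>x. exceeds h (s j) (w (i (s j))) x * \<bar>w (i (s k)) x\<bar> \<partial>M) \<le> (1/8) ^ j * \<epsilon>"
      using s(2)[of j] by (auto simp: Q_def)
    also have "\<dots> \<le> (1/8) ^ (j - k) * (\<integral>x. exceeds h (s k) (w (i (s k))) x * \<bar>w (i (s k)) x\<bar> \<partial>M)"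
      using i(2)[of "s k"] \<open>0 < \<epsilon>\<close> by (intro mult_mono power_decreasing) auto
    finally show "(\<integral>x. exceeds h (s j) (w (i (s j))) x * \<bar>w (i (s k)) x\<bar> \<partial>M)
      \<le> (1/8) ^ (j - k) * (\<integral>x. exceeds h (s k) (w (i (s k))) x * \<bar>w (i (s k)) x\<bar> \<partial>M)" .
  qed auto
  then have "\<epsilon> \<le> 0"
    using i(2) by (intro LIMSEQ_le_const[of _ "0::real" \<epsilon>]) (auto intro: less_imp_le)
  with \<open>0 < \<epsilon>\<close> show False by simp
qed

section \<open>Arithmetic means in the integrable case\<close>

text \<open>The first bound is the better one for small \<open>b\<close>, the second for large \<open>b\<close>. The factor \<open>a / sqrt (a\<^sup>2 + c\<^sup>2)\<close>
is the derivative of the potential; as it is bounded by \<open>1\<close>, it is an admissible test function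
for weak convergence in \<open>L\<^sup>1\<close>.\<close>

lemma sqrt_potential_increment:
  fixes a b c :: real
  assumes "0 < c"
  shows "sqrt ((a + b)\<^sup>2 + c\<^sup>2) \<le> sqrt (a\<^sup>2 + c\<^sup>2) + a / sqrt (a\<^sup>2 + c\<^sup>2) * b + b\<^sup>2 / (2 * c)"
    and "sqrt ((a + b)\<^sup>2 + c\<^sup>2) \<le> sqrt (a\<^sup>2 + c\<^sup>2) + a / sqrt (a\<^sup>2 + c\<^sup>2) * b + 2 * \<bar>b\<bar>"
    and "\<bar>a / sqrt (a\<^sup>2 + c\<^sup>2)\<bar> \<le> 1"
proof -
  define r t where "r = sqrt (a\<^sup>2 + c\<^sup>2)" and "t = sqrt ((a + b)\<^sup>2 + c\<^sup>2)"
  have r2: "r\<^sup>2 = a\<^sup>2 + c\<^sup>2" and t2: "t\<^sup>2 = (a + b)\<^sup>2 + c\<^sup>2"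
    by (simp_all add: r_def t_def)
  have "c \<le> r" unfolding r_def by (rule real_le_rsqrt) simp
  with assms have r: "0 < r" by simp
  have "\<bar>a\<bar> \<le> r" unfolding r_def by (rule real_le_rsqrt) simp
  then show slope: "\<bar>a / sqrt (a\<^sup>2 + c\<^sup>2)\<bar> \<le> 1"
    using r by (simp add: abs_div flip: r_def)
  \<comment> \<open>The tangent to the concave square root at \<open>r\<^sup>2\<close>, evaluated at \<open>t\<^sup>2\<close>.\<close>
  have "2 * r * t \<le> r\<^sup>2 + t\<^sup>2" using sum_squares_bound[of r t] by simp
  also have "\<dots> = 2 * r\<^sup>2 + 2 * a * b + b\<^sup>2"
    unfolding r2 t2 by (simp add: power2_eq_square algebra_simps)
  also have "\<dots> = 2 * r * (r + a / r * b + b\<^sup>2 / (2 * r))"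
    using r by (simp add: field_simps power2_eq_square)
  finally have "t \<le> r + a / r * b + b\<^sup>2 / (2 * r)" using r by simp
  also have "b\<^sup>2 / (2 * r) \<le> b\<^sup>2 / (2 * c)" using \<open>c \<le> r\<close> assms by (intro divide_left_mono) auto
  finally show "sqrt ((a + b)\<^sup>2 + c\<^sup>2) \<le> sqrt (a\<^sup>2 + c\<^sup>2) + a / sqrt (a\<^sup>2 + c\<^sup>2) * b + b\<^sup>2 / (2 * c)"
    by (simp add: r_def t_def)
  have "t \<le> r + \<bar>b\<bar>"
    unfolding t_def r_def using real_sqrt_sum_squares_triangle_ineq[of a b c 0] by simp
  moreover have "- \<bar>b\<bar> \<le> a / r * b"
  proof -
    have "\<bar>a / r * b\<bar> \<le> 1 * \<bar>b\<bar>"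
      using slope unfolding r_def[symmetric] abs_mult by (intro mult_right_mono) auto
    then show ?thesis by linarith
  qed
  ultimately show "sqrt ((a + b)\<^sup>2 + c\<^sup>2) \<le> sqrt (a\<^sup>2 + c\<^sup>2) + a / sqrt (a\<^sup>2 + c\<^sup>2) * b + 2 * \<bar>b\<bar>"
    by (simp flip: r_def t_def)
qed


text \<open>The constant \<open>A\<close> may depend on \<open>e\<close>: in the applications it contains a potential or a remainder
constant that grows without bound as \<open>e\<close> decreases.\<close>

lemma nonneg_tendsto_zeroI:
  fixes Z G :: "nat \<Rightarrow> real"
  assumes Z: "\<And>k. 0 \<le> Z k" and G: "G \<longlonglongrightarrow> 0"
    and bound: "\<And>e. 0 < e \<Longrightarrow> \<exists>A. eventually (\<lambda>k. Z k \<le> A * G k + e) sequentially"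
  shows "Z \<longlonglongrightarrow> 0"
proof (rule tendstoI)
  fix e :: real assume "0 < e"
  then obtain A where A: "eventually (\<lambda>k. Z k \<le> A * G k + e / 2) sequentially"
    using bound[of "e / 2"] by auto
  have "(\<lambda>k. A * G k) \<longlonglongrightarrow> 0" using G by (rule tendsto_mult_right_zero)
  then have "eventually (\<lambda>k. A * G k < e / 2) sequentially"
    using \<open>0 < e\<close> by (intro order_tendstoD(2)[where y=0]) auto
  with A show "eventually (\<lambda>k. dist (Z k) 0 < e) sequentially"
    by eventually_elim (use Z in auto)
qed

lemma sum_list_map_upt: "(\<Sum>m\<leftarrow>map s [0..<k]. f m) = (\<Sum>r<k. f (s r))"
  for f :: "nat \<Rightarrow> real"
  by (induction k) auto

text \<open>The parameter \<open>K\<close> of the potential must be large to make the remainder small, but how large depends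
on the final accuracy \<open>e\<close>, whereas the subsequence must not. Hence the step after \<open>k\<close> chosen indices
controls the slopes for all \<open>K \<le> k\<close>; for any fixed \<open>K\<close> this covers all but finitely many steps, and
the potential reached before them is a constant that the division by \<open>k\<close> removes.\<close>

lemma L1_cesaro_selection:
  fixes h :: "'a \<Rightarrow> real"
  assumes null: "L1_weakly_null M w" and h: "integrable M h" "\<And>x. 0 < h x"
  shows "\<exists>Q. (\<forall>l. eventually (Q l) sequentially) \<and>
    (\<forall>s. (\<forall>k. Q (map s [0..<k]) (s k)) \<longrightarrow>
      (\<lambda>k. (\<integral>x. \<bar>\<Sum>r<k. w (s r) x\<bar> \<partial>M) / real k) \<longlonglongrightarrow> 0)"
proof -
  have int_w: "integrable M (w i)" for i using null by (simp add: L1_weakly_null_def)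
  then have [measurable]: "w i \<in> borel_measurable M" "h \<in> borel_measurable M" for i using h by auto
  define slope where "slope K f x = f x / sqrt ((f x)\<^sup>2 + (real K * h x)\<^sup>2)" for K :: nat and f x
  have slope_le: "\<bar>slope K f x\<bar> \<le> 1" if "0 < K" for K f x
    unfolding slope_def using that h(2) by (intro sqrt_potential_increment(3)) auto
  define Q where "Q l n \<longleftrightarrow> (\<forall>K\<in>{1..length l}.
    \<bar>\<integral>x. w n x * slope K (\<lambda>x. \<Sum>m\<leftarrow>l. w m x) x \<partial>M\<bar> \<le> 1 / real K)" for l n
  have "eventually (Q l) sequentially" for l
    unfolding Q_def
  proof (intro eventually_ball_finite ballI)
    fix K assume K: "K \<in> {1..length l}"
    have [measurable]: "(\<lambda>x. \<Sum>m\<leftarrow>l. w m x) \<in> borel_measurable M"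
      by (induction l) auto
    have "slope K (\<lambda>x. \<Sum>m\<leftarrow>l. w m x) \<in> borel_measurable M"
      unfolding slope_def by measurable
    then have "(\<lambda>n. \<integral>x. w n x * slope K (\<lambda>x. \<Sum>m\<leftarrow>l. w m x) x \<partial>M) \<longlonglongrightarrow> 0"
      using null slope_le K by (auto simp: L1_weakly_null_def)
    then have "(\<lambda>n. \<bar>\<integral>x. w n x * slope K (\<lambda>x. \<Sum>m\<leftarrow>l. w m x) x \<partial>M\<bar>) \<longlonglongrightarrow> 0"
      by (rule tendsto_rabs_zero)
    from order_tendstoD(2)[OF this, of "1 / real K"] K
    show "eventually (\<lambda>n. \<bar>\<integral>x. w n x * slope K (\<lambda>x. \<Sum>m\<leftarrow>l. w m x) x \<partial>M\<bar> \<le> 1 / real K) sequentially"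
      by (auto elim: eventually_mono)
  qed simp
  moreover have "(\<lambda>k. (\<integral>x. \<bar>\<Sum>r<k. w (s r) x\<bar> \<partial>M) / real k) \<longlonglongrightarrow> 0"
    if s: "\<And>k. Q (map s [0..<k]) (s k)" for s
  proof (rule nonneg_tendsto_zeroI[where G="\<lambda>k. 1 / real k"])
    show "(\<lambda>k. 1 / real k) \<longlonglongrightarrow> 0" by (rule lim_1_over_n)
    show "0 \<le> (\<integral>x. \<bar>\<Sum>r<k. w (s r) x\<bar> \<partial>M) / real k" for k by simp
    define S where "S k x = (\<Sum>r<k. w (s r) x)" for k x
    have int_S: "integrable M (S k)" for k unfolding S_def using int_w by auto
    then have [measurable]: "S k \<in> borel_measurable M" for k by auto
    define G where "G K k x = sqrt ((S k x)\<^sup>2 + (real K * h x)\<^sup>2)" for K k x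
    have G_ge: "\<bar>S k x\<bar> \<le> G K k x" for K k x
      unfolding G_def by (rule real_le_rsqrt) simp
    have int_G: "integrable M (G K k)" for K k
    proof (rule Bochner_Integration.integrable_bound)
      show "integrable M (\<lambda>x. \<bar>S k x\<bar> + real K * h x)" using int_S h by auto
      show "G K k \<in> borel_measurable M" unfolding G_def by measurable
      have "G K k x \<le> \<bar>S k x\<bar> + real K * h x" for x
        unfolding G_def using sqrt_sum_squares_le_sum_abs[of "S k x" "real K * h x"] h(2)[of x] by simp
      moreover have "0 \<le> G K k x" for x by (simp add: G_def)
      ultimately have "norm (G K k x) \<le> norm (\<bar>S k x\<bar> + real K * h x)" for x
        by (smt (verit) real_norm_def)
      then show "AE x in M. norm (G K k x) \<le> norm (\<bar>S k x\<bar> + real K * h x)" by simp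
    qed
    fix e :: real assume "0 < e"
    obtain N where N: "\<And>i. (\<integral>x. exceeds h N (w i) x * \<bar>w i x\<bar> \<partial>M) \<le> e / 4"
      using L1_weakly_null_equiintegrable[of M w h "e / 4", OF null h] \<open>0 < e\<close> by auto
    \<comment> \<open>\<open>B / K\<close> bounds the selection error \<open>1 / K\<close> plus the quadratic remainder on the set where \<open>\<bar>w i\<bar> \<le> N * h\<close>.\<close>
    define B where "B = 1 + (real N)\<^sup>2 / 2 * (\<integral>x. h x \<partial>M)"
    have "(\<lambda>K. B / real K) \<longlonglongrightarrow> 0"
      by (rule lim_const_over_n)
    then have "eventually (\<lambda>K. B / real K < e / 2) sequentially"
      using \<open>0 < e\<close> by (intro order_tendstoD(2)[where y=0]) auto
    then have "eventually (\<lambda>K. B / real K < e / 2 \<and> 0 < K) sequentially"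
      using eventually_gt_at_top[of "0::nat"] by eventually_elim auto
    then obtain K where K: "B / real K < e / 2" "0 < K" by (auto simp: eventually_sequentially)
    have step: "(\<integral>x. G K (Suc k) x \<partial>M) \<le> (\<integral>x. G K k x \<partial>M) + e" if "K \<le> k" for k
    proof -
      let ?e = "\<lambda>x. exceeds h N (w (s k)) x * \<bar>w (s k) x\<bar>"
      have int_slope: "integrable M (\<lambda>x. w (s k) x * slope K (S k) x)"
        using slope_le[OF K(2)] int_w by (intro integrable_mult_bounded[where B=1]) (auto simp: slope_def)
      have int_e: "integrable M ?e"
        using integrable_mult_bounded[OF integrable_abs[OF int_w[of "s k"]], of "exceeds h N (w (s k))" 1]
        by (simp add: mult.commute)
      have "(\<integral>x. G K (Suc k) x \<partial>M) \<le>
          (\<integral>x. G K k x + w (s k) x * slope K (S k) x + (real N)\<^sup>2 / (2 * real K) * h x + 2 * ?e x \<partial>M)"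
      proof (rule integral_mono)
        fix x
        have Kh: "0 < real K * h x" using K h by simp
        note incr = sqrt_potential_increment(1,2)[OF Kh, of "S k x" "w (s k) x"]
        show "G K (Suc k) x \<le> G K k x + w (s k) x * slope K (S k) x + (real N)\<^sup>2 / (2 * real K) * h x + 2 * ?e x"
        proof (cases "real N * h x < \<bar>w (s k) x\<bar>")
          case True
          have "0 \<le> (real N)\<^sup>2 / (2 * real K) * h x" using h(2)[of x] by (simp add: less_imp_le)
          with True incr(2) show ?thesis
            by (simp add: G_def S_def slope_def exceeds_def mult.commute add.commute)
        next
          case False
          then have "\<bar>w (s k) x\<bar>\<^sup>2 \<le> (real N * h x)\<^sup>2" by (intro power_mono) auto
          then have "(w (s k) x)\<^sup>2 / (2 * (real K * h x)) \<le> (real N * h x)\<^sup>2 / (2 * (real K * h x))"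
            using Kh by (intro divide_right_mono) auto
          also have "\<dots> = (real N)\<^sup>2 / (2 * real K) * h x"
            using h(2)[of x] K by (simp add: field_simps power2_eq_square)
          finally show ?thesis using False incr(1)
            by (simp add: G_def S_def slope_def exceeds_def mult.commute add.commute)
        qed
      qed (use int_G int_slope int_e h in auto)
      also have "\<dots> = (\<integral>x. G K k x \<partial>M) + (\<integral>x. w (s k) x * slope K (S k) x \<partial>M)
          + (real N)\<^sup>2 / (2 * real K) * (\<integral>x. h x \<partial>M) + 2 * (\<integral>x. ?e x \<partial>M)"
        using int_G int_slope int_e h by simp
      finally have "(\<integral>x. G K (Suc k) x \<partial>M) \<le> \<dots>" .
      moreover have "\<bar>\<integral>x. w (s k) x * slope K (S k) x \<partial>M\<bar> \<le> 1 / real K"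
      proof -
        have "S k = (\<lambda>x. \<Sum>m\<leftarrow>map s [0..<k]. w m x)"
          by (simp only: sum_list_map_upt S_def[abs_def])
        then show ?thesis using s[of k] K(2) that unfolding Q_def by simp
      qed
      moreover have "(\<integral>x. ?e x \<partial>M) \<le> e / 4" by (rule N)
      moreover have "1 / real K + (real N)\<^sup>2 / (2 * real K) * (\<integral>x. h x \<partial>M) = B / real K"
        using K by (simp add: B_def field_simps)
      ultimately show ?thesis using K(1) by linarith
    qed
    have growth: "(\<integral>x. G K (K + n) x \<partial>M) \<le> (\<integral>x. G K K x \<partial>M) + e * real n" for n
    proof (induction n)
      case (Suc n)
      with step[of "K + n"] show ?case by (simp add: algebra_simps)
    qed simp
    have "(\<integral>x. \<bar>S k x\<bar> \<partial>M) / real k \<le> (\<integral>x. G K K x \<partial>M) * (1 / real k) + e" if "K \<le> k" for k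
    proof -
      have "(\<integral>x. \<bar>S k x\<bar> \<partial>M) \<le> (\<integral>x. G K k x \<partial>M)"
        using int_S int_G G_ge by (intro integral_mono) auto
      also have "\<dots> \<le> (\<integral>x. G K K x \<partial>M) + e * real (k - K)"
        using growth[of "k - K"] that by simp
      also have "\<dots> \<le> (\<integral>x. G K K x \<partial>M) + e * real k"
        using \<open>0 < e\<close> by (intro add_left_mono mult_left_mono) auto
      finally show ?thesis using that K(2) by (simp add: field_simps)
    qed
    then show "\<exists>A. eventually (\<lambda>k. (\<integral>x. \<bar>\<Sum>r<k. w (s r) x\<bar> \<partial>M) / real k \<le> A * (1 / real k) + e) sequentially"
      unfolding eventually_sequentially S_def by blast
  qed
  ultimately show ?thesis by (intro exI[of _ Q]) blast
qed

section \<open>Elementary inequalities for powers\<close>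

lemma powr_young:
  fixes a b p :: real
  assumes "1 < p" "0 \<le> a" "0 \<le> b"
  shows "a * b powr (p - 1) \<le> a powr p / p + (p - 1) / p * b powr p"
proof -
  have "1 < p / (p - 1)" "1 / p + 1 / (p / (p - 1)) = 1" using assms by (auto simp: field_simps)
  from Youngs_inequality[OF assms(1) this assms(2), of "b powr (p - 1)"] assms
  show ?thesis by (simp add: powr_powr mult.commute)
qed

text \<open>For \<open>q = p - 1\<close> this is, up to the factor \<open>p\<close>, the derivative of \<open>\<bar>a\<bar> powr p\<close>.\<close>

definition signed_powr :: "real \<Rightarrow> real \<Rightarrow> real" where
  "signed_powr q a = sgn a * \<bar>a\<bar> powr q"

lemma signed_powr_measurable [measurable]: "signed_powr q \<in> borel_measurable borel"
  unfolding signed_powr_def by measurable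

lemma abs_signed_powr [simp]: "\<bar>signed_powr q a\<bar> = \<bar>a\<bar> powr q"
  by (auto simp: signed_powr_def abs_mult sgn_if)

text \<open>Convexity of \<open>\<bar>t\<bar> powr p\<close> in the form of the tangent line at \<open>x\<close>. After
expansion it becomes Young's inequality for \<open>\<bar>x\<bar> powr (p - 1) * \<bar>y\<bar>\<close>.\<close>

lemma abs_powr_tangent:
  fixes x y p :: real
  assumes "1 < p"
  shows "\<bar>x\<bar> powr p \<le> \<bar>y\<bar> powr p + p * signed_powr (p - 1) x * (x - y)"
proof -
  have "signed_powr (p - 1) x * x = \<bar>x\<bar> powr (p - 1) * \<bar>x\<bar>"
    by (auto simp: signed_powr_def sgn_if)
  also have "\<dots> = \<bar>x\<bar> powr p"
    using powr_add[of "\<bar>x\<bar>" "p - 1" 1] by (cases "x = 0") auto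
  finally have *: "signed_powr (p - 1) x * x = \<bar>x\<bar> powr p" .
  have "signed_powr (p - 1) x * y \<le> \<bar>signed_powr (p - 1) x\<bar> * \<bar>y\<bar>"
    by (metis abs_ge_self abs_mult)
  also have "\<dots> \<le> \<bar>y\<bar> powr p / p + (p - 1) / p * \<bar>x\<bar> powr p"
    using powr_young[OF assms, of "\<bar>y\<bar>" "\<bar>x\<bar>"] by (simp add: mult.commute)
  finally have "p * (signed_powr (p - 1) x * y) \<le> p * (\<bar>y\<bar> powr p / p + (p - 1) / p * \<bar>x\<bar> powr p)"
    using assms by (intro mult_left_mono) auto
  also have "\<dots> = \<bar>y\<bar> powr p + (p - 1) * \<bar>x\<bar> powr p" using assms by (simp add: distrib_left)
  finally have "p * (signed_powr (p - 1) x * y) \<le> \<bar>y\<bar> powr p + (p - 1) * \<bar>x\<bar> powr p" .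
  moreover have "p * signed_powr (p - 1) x * (x - y) = p * \<bar>x\<bar> powr p - p * (signed_powr (p - 1) x * y)"
    by (simp add: right_diff_distrib * mult.assoc)
  ultimately show ?thesis by (simp add: left_diff_distrib)
qed

text \<open>Jensen's inequality for the uniform weights, obtained by adding the tangent inequalities at the mean,
whose linear terms cancel.\<close>

lemma abs_powr_sum_le:
  fixes f :: "nat \<Rightarrow> real"
  assumes "1 < p"
  shows "\<bar>\<Sum>r<k. f r\<bar> powr p \<le> real k powr (p - 1) * (\<Sum>r<k. \<bar>f r\<bar> powr p)"
proof (cases "k = 0")
  case False
  define m where "m = (\<Sum>r<k. f r) / real k"
  have "(\<Sum>r<k. \<bar>m\<bar> powr p) \<le> (\<Sum>r<k. \<bar>f r\<bar> powr p + p * signed_powr (p - 1) m * (m - f r))"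
    by (intro sum_mono abs_powr_tangent assms)
  also have "\<dots> = (\<Sum>r<k. \<bar>f r\<bar> powr p) + p * signed_powr (p - 1) m * (real k * m - (\<Sum>r<k. f r))"
    by (simp add: sum.distrib sum_subtractf flip: sum_distrib_left)
  also have "real k * m = (\<Sum>r<k. f r)" using False by (simp add: m_def)
  finally have "real k * \<bar>m\<bar> powr p \<le> (\<Sum>r<k. \<bar>f r\<bar> powr p)" by simp
  then have "real k powr (p - 1) * (real k * \<bar>m\<bar> powr p) \<le> real k powr (p - 1) * (\<Sum>r<k. \<bar>f r\<bar> powr p)"
    by (intro mult_left_mono) auto
  also have "real k powr (p - 1) * (real k * \<bar>m\<bar> powr p) = real k powr p * \<bar>m\<bar> powr p"
    using powr_add[of "real k" "p - 1" 1] False by simp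
  also have "\<dots> = \<bar>real k * m\<bar> powr p"
    by (simp add: abs_mult powr_mult)
  finally show ?thesis using False by (simp add: m_def)
qed simp

text \<open>The tangent inequality at \<open>a + b\<close> bounds the second-order remainder by \<open>p * \<bar>b\<bar>\<close> times the change of
\<open>signed_powr (p - 1)\<close> between \<open>a\<close> and \<open>a + b\<close>. If \<open>b\<close> is small relative to \<open>a\<close>, this change is a small
multiple of \<open>\<bar>a\<bar> powr (p - 1)\<close>, by homogeneity and continuity at \<open>1\<close>; otherwise \<open>\<bar>a\<bar>\<close> is bounded by a
multiple of \<open>\<bar>b\<bar>\<close>. This argument treats exponents below and above \<open>2\<close> alike.\<close>

lemma abs_powr_increment:
  fixes p \<eta> :: real
  assumes "1 < p" "0 < \<eta>"
  shows "\<exists>D\<ge>0. \<forall>a b. \<bar>a + b\<bar> powr p \<le> \<bar>a\<bar> powr p + p * signed_powr (p - 1) a * b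
    + \<eta> * (\<bar>a\<bar> powr (p - 1) * \<bar>b\<bar>) + D * \<bar>b\<bar> powr p"
proof -
  have "((\<lambda>u. (1 + u) powr (p - 1)) \<longlongrightarrow> (1 + 0) powr (p - 1)) (at (0::real))"
    by (intro tendsto_intros) auto
  then have "eventually (\<lambda>u. \<bar>(1 + u) powr (p - 1) - 1\<bar> < \<eta> / p) (at (0::real))"
    using tendstoD[of _ _ _ "\<eta> / p"] assms by (fastforce simp: dist_real_def)
  then obtain d where d: "0 < d" "\<And>u. u \<noteq> 0 \<Longrightarrow> \<bar>u\<bar> < d \<Longrightarrow> \<bar>(1 + u) powr (p - 1) - 1\<bar> < \<eta> / p"
    by (auto simp: eventually_at dist_real_def)
  define \<delta> where "\<delta> = min d 1 / 2"
  have \<delta>: "0 < \<delta>" "\<delta> < 1" "\<delta> < d" using d(1) by (auto simp: \<delta>_def)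
  define E where "E = 2 * (1 + 1 / \<delta>) powr (p - 1)"
  have E: "0 \<le> E" by (simp add: E_def)
  have slope: "\<bar>signed_powr (p - 1) (a + b) - signed_powr (p - 1) a\<bar>
      \<le> \<eta> / p * \<bar>a\<bar> powr (p - 1) + E * \<bar>b\<bar> powr (p - 1)" for a b :: real
  proof (cases "a \<noteq> 0 \<and> \<bar>b\<bar> \<le> \<delta> * \<bar>a\<bar>")
    case True
    define u where "u = b / a"
    have u: "\<bar>u\<bar> \<le> \<delta>" "b = a * u" using True by (auto simp: u_def abs_div field_simps)
    then have pos: "0 < 1 + u" using \<delta> by linarith
    have "a + b = a * (1 + u)" by (simp add: u algebra_simps)
    then have "signed_powr (p - 1) (a + b) = signed_powr (p - 1) a * (1 + u) powr (p - 1)"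
      using pos by (simp add: signed_powr_def abs_mult sgn_mult powr_mult)
    then have "signed_powr (p - 1) (a + b) - signed_powr (p - 1) a
        = signed_powr (p - 1) a * ((1 + u) powr (p - 1) - 1)" by (simp add: algebra_simps)
    then have "\<bar>signed_powr (p - 1) (a + b) - signed_powr (p - 1) a\<bar>
        = \<bar>a\<bar> powr (p - 1) * \<bar>(1 + u) powr (p - 1) - 1\<bar>" by (simp add: abs_mult)
    also have "\<dots> \<le> \<bar>a\<bar> powr (p - 1) * (\<eta> / p)"
    proof (intro mult_left_mono)
      show "\<bar>(1 + u) powr (p - 1) - 1\<bar> \<le> \<eta> / p"
        using d(2)[of u] u(1) \<delta>(3) assms by (cases "u = 0") auto
    qed simp
    moreover have "0 \<le> E * \<bar>b\<bar> powr (p - 1)" using E by simp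
    ultimately show ?thesis by (simp add: mult.commute)
  next
    case False
    then have a: "\<bar>a\<bar> \<le> 1 / \<delta> * \<bar>b\<bar>" using \<delta>(1) by (auto simp: field_simps)
    have "\<bar>signed_powr (p - 1) (a + b) - signed_powr (p - 1) a\<bar> \<le> \<bar>a + b\<bar> powr (p - 1) + \<bar>a\<bar> powr (p - 1)"
      using abs_triangle_ineq4[of "signed_powr (p - 1) (a + b)" "signed_powr (p - 1) a"] by simp
    also have "\<dots> \<le> ((1 + 1 / \<delta>) * \<bar>b\<bar>) powr (p - 1) + ((1 + 1 / \<delta>) * \<bar>b\<bar>) powr (p - 1)"
      using a abs_triangle_ineq[of a b] assms by (intro add_mono powr_mono2) (auto simp: distrib_right)
    also have "\<dots> = E * \<bar>b\<bar> powr (p - 1)"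
      using \<delta>(1) by (simp add: E_def powr_mult)
    also have "\<dots> \<le> \<eta> / p * \<bar>a\<bar> powr (p - 1) + E * \<bar>b\<bar> powr (p - 1)" using assms by simp
    finally show ?thesis .
  qed
  have "\<bar>a + b\<bar> powr p \<le> \<bar>a\<bar> powr p + p * signed_powr (p - 1) a * b
    + \<eta> * (\<bar>a\<bar> powr (p - 1) * \<bar>b\<bar>) + p * E * \<bar>b\<bar> powr p" for a b :: real
  proof -
    define \<Delta> where "\<Delta> = signed_powr (p - 1) (a + b) - signed_powr (p - 1) a"
    have "\<Delta> * b \<le> \<bar>\<Delta>\<bar> * \<bar>b\<bar>" by (metis abs_ge_self abs_mult)
    also have "\<dots> \<le> (\<eta> / p * \<bar>a\<bar> powr (p - 1) + E * \<bar>b\<bar> powr (p - 1)) * \<bar>b\<bar>"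
      unfolding \<Delta>_def by (intro mult_right_mono slope) auto
    finally have "p * (\<Delta> * b) \<le> p * ((\<eta> / p * \<bar>a\<bar> powr (p - 1) + E * \<bar>b\<bar> powr (p - 1)) * \<bar>b\<bar>)"
      using assms by (intro mult_left_mono) auto
    also have "\<dots> = \<eta> * (\<bar>a\<bar> powr (p - 1) * \<bar>b\<bar>) + p * E * (\<bar>b\<bar> powr (p - 1) * \<bar>b\<bar>)"
      using assms by (simp add: algebra_simps)
    also have "\<bar>b\<bar> powr (p - 1) * \<bar>b\<bar> = \<bar>b\<bar> powr p"
      using powr_add[of "\<bar>b\<bar>" "p - 1" 1] by (cases "b = 0") auto
    finally have "p * (\<Delta> * b) \<le> \<eta> * (\<bar>a\<bar> powr (p - 1) * \<bar>b\<bar>) + p * E * \<bar>b\<bar> powr p" .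
    moreover have "p * signed_powr (p - 1) (a + b) * b = p * signed_powr (p - 1) a * b + p * (\<Delta> * b)"
      by (simp add: \<Delta>_def algebra_simps)
    moreover have "\<bar>a + b\<bar> powr p \<le> \<bar>a\<bar> powr p + p * signed_powr (p - 1) (a + b) * b"
      using abs_powr_tangent[OF assms(1), of "a + b" a] by simp
    ultimately show ?thesis by linarith
  qed
  moreover have "0 \<le> p * E" using assms E by simp
  ultimately show ?thesis by blast
qed

section \<open>Weakly null sequences for exponents above one\<close>

definition Lp_weakly_null :: "'a measure \<Rightarrow> real \<Rightarrow> (nat \<Rightarrow> 'a \<Rightarrow> real) \<Rightarrow> bool" where
  "Lp_weakly_null M p w \<longleftrightarrow>
     (\<forall>i. w i \<in> borel_measurable M \<and> integrable M (\<lambda>x. \<bar>w i x\<bar> powr p)) \<and>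
     (\<forall>v\<in>borel_measurable M. integrable M (\<lambda>x. \<bar>v x\<bar> powr (p / (p - 1))) \<longrightarrow>
        (\<lambda>i. \<integral>x. w i x * v x \<partial>M) \<longlonglongrightarrow> 0)"

lemma integrable_mult_conjugate:
  fixes f v :: "'a \<Rightarrow> real"
  assumes "1 < p"
    and [measurable]: "f \<in> borel_measurable M" "v \<in> borel_measurable M"
    and "integrable M (\<lambda>x. \<bar>f x\<bar> powr p)" "integrable M (\<lambda>x. \<bar>v x\<bar> powr (p / (p - 1)))"
  shows "integrable M (\<lambda>x. f x * v x)"
proof (rule Bochner_Integration.integrable_bound)
  let ?q = "p / (p - 1)"
  show "integrable M (\<lambda>x. \<bar>f x\<bar> powr p / p + \<bar>v x\<bar> powr ?q / ?q)"
    using assms by (intro Bochner_Integration.integrable_add) auto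
  have q: "1 < ?q" "1 / p + 1 / ?q = 1" using assms(1) by (auto simp: field_simps)
  have "\<bar>f x * v x\<bar> \<le> \<bar>f x\<bar> powr p / p + \<bar>v x\<bar> powr ?q / ?q" for x
    using Youngs_inequality[OF assms(1) q, of "\<bar>f x\<bar>" "\<bar>v x\<bar>"] by (simp add: abs_mult)
  then have "norm (f x * v x) \<le> norm (\<bar>f x\<bar> powr p / p + \<bar>v x\<bar> powr ?q / ?q)" for x
    unfolding real_norm_def by (meson abs_ge_self order_trans)
  then show "AE x in M. norm (f x * v x) \<le> norm (\<bar>f x\<bar> powr p / p + \<bar>v x\<bar> powr ?q / ?q)"
    by simp
qed measurable

lemma Lp_weakly_null_mult:
  assumes "1 < p" and null: "Lp_weakly_null M p w"
    and [measurable]: "v \<in> borel_measurable M" and v: "integrable M (\<lambda>x. \<bar>v x\<bar> powr (p / (p - 1)))"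
  shows "L1_weakly_null M (\<lambda>i x. w i x * v x)"
  unfolding L1_weakly_null_def
proof (intro conjI allI ballI impI)
  show "integrable M (\<lambda>x. w i x * v x)" for i
    using null assms unfolding Lp_weakly_null_def by (intro integrable_mult_conjugate[of p]) auto
  fix g :: "'a \<Rightarrow> real" assume [measurable]: "g \<in> borel_measurable M" and g: "\<forall>x. \<bar>g x\<bar> \<le> 1"
  have "integrable M (\<lambda>x. \<bar>v x * g x\<bar> powr (p / (p - 1)))"
  proof (rule Bochner_Integration.integrable_bound[OF v])
    have "\<bar>v x * g x\<bar> \<le> \<bar>v x\<bar>" for x
      using g mult_left_mono[of "\<bar>g x\<bar>" 1 "\<bar>v x\<bar>"] by (simp add: abs_mult)
    then have "\<bar>v x * g x\<bar> powr (p / (p - 1)) \<le> \<bar>v x\<bar> powr (p / (p - 1))" for x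
      using assms(1) by (intro powr_mono2) auto
    then show "AE x in M. norm (\<bar>v x * g x\<bar> powr (p / (p - 1))) \<le> norm (\<bar>v x\<bar> powr (p / (p - 1)))"
      by simp
  qed measurable
  then show "(\<lambda>i. \<integral>x. w i x * v x * g x \<partial>M) \<longlonglongrightarrow> 0"
    using null unfolding Lp_weakly_null_def by (simp add: mult.assoc)
qed

text \<open>If the norms were unbounded, let \<open>F\<close> be the sum of the functions \<open>\<bar>w (i k)\<bar> powr p\<close>, normalised to
integral \<open>(1/2) ^ k\<close>, along a subsequence of rapidly growing norms. The power of \<open>F\<close> with exponent
\<open>(p - 1) / p\<close> is conjugate-integrable because \<open>F\<close> is integrable, and pairing it with \<open>\<bar>w (i k)\<bar>\<close> gives
at least \<open>2 ^ k\<close>. The products of \<open>w i\<close> with this power of \<open>F\<close> are weakly null in \<open>L\<^sup>1\<close>, hence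
bounded in norm.\<close>

lemma Lp_weakly_null_bounded:
  assumes "1 < p" and null: "Lp_weakly_null M p w"
  shows "\<exists>C. \<forall>i. (\<integral>x. \<bar>w i x\<bar> powr p \<partial>M) \<le> C"
proof (rule ccontr)
  assume "\<nexists>C. \<forall>i. (\<integral>x. \<bar>w i x\<bar> powr p \<partial>M) \<le> C"
  then have "\<exists>i. (4 ^ k) powr p < (\<integral>x. \<bar>w i x\<bar> powr p \<partial>M)" for k :: nat
    by (meson not_le)
  then obtain i where i: "\<And>k :: nat. (4 ^ k) powr p < (\<integral>x. \<bar>w (i k) x\<bar> powr p \<partial>M)" by metis
  have [measurable]: "w i \<in> borel_measurable M" and int_w: "integrable M (\<lambda>x. \<bar>w i x\<bar> powr p)" for i
    using null by (auto simp: Lp_weakly_null_def)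
  define a where "a k = (\<integral>x. \<bar>w (i k) x\<bar> powr p \<partial>M)" for k
  define c where "c k = (1/2) ^ k / a k" for k
  have a: "(4 ^ k) powr p < a k" for k using i by (simp add: a_def)
  have a_pos: "0 < a k" for k by (rule le_less_trans[OF _ a]) simp
  have c_pos: "0 < c k" for k using a_pos by (simp add: c_def)
  define f where "f k x = c k * \<bar>w (i k) x\<bar> powr p" for k x
  have f_nonneg: "0 \<le> f k x" for k x using c_pos[of k] by (simp add: f_def)
  have int_f: "integrable M (f k)" for k using int_w by (simp add: f_def[abs_def])
  have "(\<integral>x. f k x \<partial>M) = (1/2) ^ k" for k
    using a_pos[of k] by (simp add: f_def a_def[symmetric] c_def)
  then have "summable (\<lambda>k. \<integral>x. f k x \<partial>M)" by (simp add: summable_geometric)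
  note series = nonneg_series_integrable[of M f, OF int_f f_nonneg this]
  \<comment> \<open>Where the series diverges its sum is unspecified; the absolute value keeps \<open>F\<close> nonnegative there.\<close>
  define F where "F x = \<bar>\<Sum>k. f k x\<bar>" for x
  have int_F: "integrable M F" using series(2) by (simp add: F_def[abs_def])
  then have [measurable]: "F \<in> borel_measurable M" by auto
  define \<theta> where "\<theta> = (p - 1) / p"
  have \<theta>: "0 < \<theta>" "\<theta> \<le> 1" "1 - \<theta> = 1 / p" "p * \<theta> = p - 1"
    using assms(1) by (auto simp: \<theta>_def field_simps)
  have "AE x in M. \<forall>k. f k x \<le> F x"
    using series(1)
  proof eventually_elim
    case (elim x)
    show ?case
    proof
      fix k
      have "(\<Sum>j\<in>{k}. f j x) \<le> (\<Sum>j. f j x)" using elim f_nonneg by (intro sum_le_suminf) auto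
      then show "f k x \<le> F x" by (simp add: F_def)
    qed
  qed
  have int_v: "integrable M (\<lambda>x. \<bar>F x powr \<theta>\<bar> powr (p / (p - 1)))"
  proof -
    have "\<bar>F x powr \<theta>\<bar> powr (p / (p - 1)) = F x" for x
      using assms(1) by (simp add: powr_powr \<theta>_def F_def)
    then show ?thesis using int_F by simp
  qed
  have null_v: "L1_weakly_null M (\<lambda>i x. w i x * F x powr \<theta>)"
    by (rule Lp_weakly_null_mult[OF assms _ int_v]) measurable
  then obtain C where C: "\<And>i. (\<integral>x. \<bar>w i x * F x powr \<theta>\<bar> \<partial>M) \<le> C"
    using L1_weakly_null_bounded by blast
  have "2 ^ k \<le> C" for k
  proof -
    have "(4::real) ^ k = 2 ^ k * 2 ^ k" by (simp flip: power_mult_distrib)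
    then have "2 ^ k = (1/2) ^ k * ((4 ^ k) powr p) powr (1 / p)"
      using assms(1) by (simp add: powr_powr power_divide)
    also have "\<dots> \<le> ((1/2) ^ k) powr \<theta> * a k powr (1 / p)"
    proof (intro mult_mono powr_mono2)
      show "(1/2::real) ^ k \<le> ((1/2) ^ k) powr \<theta>"
        using powr_mono'[of \<theta> 1 "(1/2) ^ k"] \<theta> by (simp add: power_le_one)
    qed (use a[of k] assms in auto)
    also have "\<dots> = c k powr \<theta> * a k"
      using a_pos[of k] powr_diff[of "a k" 1 \<theta>] by (simp add: c_def powr_divide \<theta>(3))
    also have "\<dots> = (\<integral>x. c k powr \<theta> * \<bar>w (i k) x\<bar> powr p \<partial>M)"
      by (simp add: a_def)
    also have "\<dots> \<le> (\<integral>x. \<bar>w (i k) x * F x powr \<theta>\<bar> \<partial>M)"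
    proof (rule integral_mono_AE)
      show "integrable M (\<lambda>x. \<bar>w (i k) x * F x powr \<theta>\<bar>)"
        using null_v by (simp add: L1_weakly_null_def)
      show "AE x in M. c k powr \<theta> * \<bar>w (i k) x\<bar> powr p \<le> \<bar>w (i k) x * F x powr \<theta>\<bar>"
        using \<open>AE x in M. \<forall>k. f k x \<le> F x\<close>
      proof eventually_elim
        case (elim x)
        have "\<bar>w (i k) x\<bar> powr p = \<bar>w (i k) x\<bar> * \<bar>w (i k) x\<bar> powr (p - 1)"
          using powr_add[of "\<bar>w (i k) x\<bar>" 1 "p - 1"] by (cases "w (i k) x = 0") auto
        moreover have "f k x powr \<theta> = c k powr \<theta> * \<bar>w (i k) x\<bar> powr (p - 1)"
          by (simp add: f_def powr_mult powr_powr \<theta>(4))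
        ultimately have "c k powr \<theta> * \<bar>w (i k) x\<bar> powr p = \<bar>w (i k) x\<bar> * f k x powr \<theta>"
          by (simp only: mult_ac)
        also have "\<dots> \<le> \<bar>w (i k) x\<bar> * F x powr \<theta>"
          using elim f_nonneg \<theta> by (intro mult_left_mono powr_mono2) auto
        finally show ?case by (simp add: abs_mult)
      qed
    qed (use int_w in auto)
    also have "\<dots> \<le> C" by (rule C)
    finally show ?thesis .
  qed
  moreover obtain n where "C < 2 ^ n" using real_arch_pow[of "2::real" C] by auto
  ultimately show False by (meson not_le)
qed

section \<open>Arithmetic means for exponents above one\<close>

text \<open>The \<open>p\<close>-th power of the norm of \<open>S k\<close> is at most \<open>C * k powr p\<close> by Jensen's inequality. Inserting this
trivial bound into the increment estimate shows that each step adds at most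
\<open>B + e * k powr (p - 1)\<close>, and these increments sum to \<open>B * k + e * k powr p\<close> with \<open>e\<close> arbitrarily
small.\<close>

lemma Lp_cesaro_selection:
  assumes "1 < p" and null: "Lp_weakly_null M p w"
  shows "\<exists>Q. (\<forall>l. eventually (Q l) sequentially) \<and>
    (\<forall>s. (\<forall>k. Q (map s [0..<k]) (s k)) \<longrightarrow>
      (\<lambda>k. (\<integral>x. \<bar>\<Sum>r<k. w (s r) x\<bar> powr p \<partial>M) / real k powr p) \<longlonglongrightarrow> 0)"
proof -
  have [measurable]: "w i \<in> borel_measurable M" and int_w: "integrable M (\<lambda>x. \<bar>w i x\<bar> powr p)" for i
    using null by (auto simp: Lp_weakly_null_def)
  obtain C where C: "\<And>i. (\<integral>x. \<bar>w i x\<bar> powr p \<partial>M) \<le> C"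
    using Lp_weakly_null_bounded[OF assms] by blast
  have "0 \<le> (\<integral>x. \<bar>w 0 x\<bar> powr p \<partial>M)" by simp
  with C[of 0] have C_nonneg: "0 \<le> C" by linarith
  have int_sum: "integrable M (\<lambda>x. \<bar>\<Sum>r<k. w (s r) x\<bar> powr p)" for s :: "nat \<Rightarrow> nat" and k
  proof (rule Bochner_Integration.integrable_bound)
    show "integrable M (\<lambda>x. real k powr (p - 1) * (\<Sum>r<k. \<bar>w (s r) x\<bar> powr p))"
      using int_w by simp
    have "norm (\<bar>\<Sum>r<k. w (s r) x\<bar> powr p) \<le> norm (real k powr (p - 1) * (\<Sum>r<k. \<bar>w (s r) x\<bar> powr p))" for x
      using abs_powr_sum_le[OF assms(1), of "\<lambda>r. w (s r) x" k] by (simp add: sum_nonneg abs_mult)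
    then show "AE x in M. norm (\<bar>\<Sum>r<k. w (s r) x\<bar> powr p)
        \<le> norm (real k powr (p - 1) * (\<Sum>r<k. \<bar>w (s r) x\<bar> powr p))" by simp
  qed measurable
  define \<psi> where "\<psi> = signed_powr (p - 1)"
  have \<psi>_meas [measurable]: "\<psi> \<in> borel_measurable borel" by (simp add: \<psi>_def)
  have \<psi>_conj: "\<bar>\<psi> a\<bar> powr (p / (p - 1)) = \<bar>a\<bar> powr p" for a
    using assms(1) by (simp add: \<psi>_def powr_powr)
  define Q where "Q l n \<longleftrightarrow> \<bar>\<integral>x. w n x * \<psi> (\<Sum>m\<leftarrow>l. w m x) \<partial>M\<bar> \<le> 1" for l n
  have "eventually (Q l) sequentially" for l
  proof -
    have [measurable]: "(\<lambda>x. \<Sum>m\<leftarrow>l. w m x) \<in> borel_measurable M"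
      by (induction l) auto
    have "integrable M (\<lambda>x. \<bar>\<Sum>m\<leftarrow>map ((!) l) [0..<length l]. w m x\<bar> powr p)"
      unfolding sum_list_map_upt by (rule int_sum)
    then have "integrable M (\<lambda>x. \<bar>\<psi> (\<Sum>m\<leftarrow>l. w m x)\<bar> powr (p / (p - 1)))"
      by (simp add: \<psi>_conj map_nth)
    then have "(\<lambda>n. \<integral>x. w n x * \<psi> (\<Sum>m\<leftarrow>l. w m x) \<partial>M) \<longlonglongrightarrow> 0"
      using null by (simp add: Lp_weakly_null_def)
    then have "(\<lambda>n. \<bar>\<integral>x. w n x * \<psi> (\<Sum>m\<leftarrow>l. w m x) \<partial>M\<bar>) \<longlonglongrightarrow> 0"
      by (rule tendsto_rabs_zero)
    from order_tendstoD(2)[OF this, of 1] show ?thesis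
      unfolding Q_def by (auto elim: eventually_mono)
  qed
  moreover have "(\<lambda>k. (\<integral>x. \<bar>\<Sum>r<k. w (s r) x\<bar> powr p \<partial>M) / real k powr p) \<longlonglongrightarrow> 0"
    if s: "\<And>k. Q (map s [0..<k]) (s k)" for s
  proof (rule nonneg_tendsto_zeroI[where G="\<lambda>k. real k powr (1 - p)"])
    show "(\<lambda>k. real k powr (1 - p)) \<longlonglongrightarrow> 0"
      using assms(1) by (intro tendsto_neg_powr filterlim_real_sequentially) auto
    show "0 \<le> (\<integral>x. \<bar>\<Sum>r<k. w (s r) x\<bar> powr p \<partial>M) / real k powr p" for k by simp
    define S where "S k x = (\<Sum>r<k. w (s r) x)" for k x
    have [measurable]: "S k \<in> borel_measurable M" for k unfolding S_def by measurable
    have int_S: "integrable M (\<lambda>x. \<bar>S k x\<bar> powr p)" for k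
      unfolding S_def by (rule int_sum)
    have S_le: "(\<integral>x. \<bar>S k x\<bar> powr p \<partial>M) \<le> real k powr p * C" for k
    proof -
      have "(\<integral>x. \<bar>S k x\<bar> powr p \<partial>M) \<le> (\<integral>x. real k powr (p - 1) * (\<Sum>r<k. \<bar>w (s r) x\<bar> powr p) \<partial>M)"
        using int_S int_w unfolding S_def by (intro integral_mono abs_powr_sum_le[OF assms(1)]) auto
      also have "\<dots> = real k powr (p - 1) * (\<Sum>r<k. \<integral>x. \<bar>w (s r) x\<bar> powr p \<partial>M)"
        using int_w by simp
      also have "\<dots> \<le> real k powr (p - 1) * (\<Sum>r<k. C)"
        by (intro mult_left_mono sum_mono C) auto
      also have "\<dots> = real k powr p * C"
        using powr_add[of "real k" "p - 1" 1] by (cases "k = 0") auto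
      finally show ?thesis .
    qed
    fix e :: real assume "0 < e"
    \<comment> \<open>The cross term contributes at most \<open>\<eta> * (C + C)\<close>: one \<open>C\<close> for \<open>S k / k\<close> and one for the new summand.\<close>
    define \<eta> where "\<eta> = e / (2 * C + 1)"
    have \<eta>: "0 < \<eta>" "\<eta> * (2 * C) \<le> e"
      using \<open>0 < e\<close> C_nonneg by (auto simp: \<eta>_def field_simps)
    obtain D where D: "0 \<le> D" "\<And>a b. \<bar>a + b\<bar> powr p \<le> \<bar>a\<bar> powr p + p * \<psi> a * b
        + \<eta> * (\<bar>a\<bar> powr (p - 1) * \<bar>b\<bar>) + D * \<bar>b\<bar> powr p"
      using abs_powr_increment[OF assms(1) \<eta>(1)] unfolding \<psi>_def by blast
    define B where "B = p + D * C"
    have step: "(\<integral>x. \<bar>S (Suc k) x\<bar> powr p \<partial>M)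
        \<le> (\<integral>x. \<bar>S k x\<bar> powr p \<partial>M) + B + e * real k powr (p - 1)" for k
    proof -
      let ?b = "\<lambda>x. w (s k) x"
      let ?c = "\<lambda>x. \<bar>S k x\<bar> powr (p - 1) * \<bar>?b x\<bar>"
      let ?d = "\<lambda>x. real k powr (p - 1) * (\<bar>S k x\<bar> powr p / real k powr p + \<bar>?b x\<bar> powr p)"
      have cross: "?c x \<le> ?d x" for x
      proof (cases "k = 0")
        case False
        define y where "y = \<bar>S k x\<bar> / real k"
        have y: "\<bar>S k x\<bar> = real k * y" "0 \<le> y" using False by (auto simp: y_def)
        have "y powr (p - 1) * \<bar>?b x\<bar> \<le> \<bar>?b x\<bar> powr p / p + (p - 1) / p * y powr p"
          using powr_young[OF assms(1), of "\<bar>?b x\<bar>" y] y(2) by (simp add: mult.commute)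
        also have "\<dots> \<le> \<bar>?b x\<bar> powr p + 1 * y powr p"
          using assms(1) mult_right_mono[of 1 p "\<bar>?b x\<bar> powr p"]
          by (intro add_mono mult_right_mono) (auto simp: field_simps)
        finally have "real k powr (p - 1) * (y powr (p - 1) * \<bar>?b x\<bar>)
            \<le> real k powr (p - 1) * (y powr p + \<bar>?b x\<bar> powr p)"
          by (intro mult_left_mono) auto
        then show ?thesis using y False by (simp add: powr_mult)
      qed (simp add: S_def)
      have int_\<psi>: "integrable M (\<lambda>x. ?b x * \<psi> (S k x))"
        using int_S int_w by (intro integrable_mult_conjugate[OF assms(1)]) (auto simp: \<psi>_conj)
      have int_d: "integrable M ?d" using int_S int_w by simp
      have "(\<integral>x. \<bar>S (Suc k) x\<bar> powr p \<partial>M) \<le> (\<integral>x. \<bar>S k x\<bar> powr p + p * (?b x * \<psi> (S k x))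
          + \<eta> * ?d x + D * \<bar>?b x\<bar> powr p \<partial>M)"
      proof (rule integral_mono)
        fix x
        have "\<bar>S (Suc k) x\<bar> powr p \<le> \<bar>S k x\<bar> powr p + p * \<psi> (S k x) * ?b x + \<eta> * ?c x + D * \<bar>?b x\<bar> powr p"
          using D(2)[of "S k x" "?b x"] by (simp add: S_def)
        also have "\<dots> \<le> \<bar>S k x\<bar> powr p + p * \<psi> (S k x) * ?b x + \<eta> * ?d x + D * \<bar>?b x\<bar> powr p"
          using cross[of x] \<eta>(1) by (intro add_mono mult_left_mono order_refl) auto
        finally show "\<bar>S (Suc k) x\<bar> powr p \<le> \<bar>S k x\<bar> powr p + p * (?b x * \<psi> (S k x))
          + \<eta> * ?d x + D * \<bar>?b x\<bar> powr p" by (simp only: mult_ac)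
      next
        show "integrable M (\<lambda>x. \<bar>S k x\<bar> powr p + p * (?b x * \<psi> (S k x)) + \<eta> * ?d x + D * \<bar>?b x\<bar> powr p)"
          by (intro Bochner_Integration.integrable_add integrable_mult_right int_S int_\<psi> int_d int_w)
      qed (rule int_S)
      also have "\<dots> = (\<integral>x. \<bar>S k x\<bar> powr p \<partial>M) + p * (\<integral>x. ?b x * \<psi> (S k x) \<partial>M)
          + \<eta> * (\<integral>x. ?d x \<partial>M) + D * (\<integral>x. \<bar>?b x\<bar> powr p \<partial>M)"
        using int_S int_\<psi> int_d int_w by simp
      also have "\<dots> \<le> (\<integral>x. \<bar>S k x\<bar> powr p \<partial>M) + p * 1 + \<eta> * (real k powr (p - 1) * (C + C)) + D * C"
      proof (intro add_mono mult_left_mono order_refl C)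
        have "S k = (\<lambda>x. \<Sum>m\<leftarrow>map s [0..<k]. w m x)"
          by (simp only: sum_list_map_upt S_def[abs_def])
        then show "(\<integral>x. ?b x * \<psi> (S k x) \<partial>M) \<le> 1" using s[of k] unfolding Q_def by simp
        have "(\<integral>x. ?d x \<partial>M) = real k powr (p - 1) *
            ((\<integral>x. \<bar>S k x\<bar> powr p \<partial>M) / real k powr p + (\<integral>x. \<bar>?b x\<bar> powr p \<partial>M))"
          using int_S int_w by simp
        also have "\<dots> \<le> real k powr (p - 1) * (C + C)"
        proof (intro mult_left_mono add_mono C)
          show "(\<integral>x. \<bar>S k x\<bar> powr p \<partial>M) / real k powr p \<le> C"
            using S_le[of k] C_nonneg by (cases "k = 0") (simp_all add: pos_divide_le_eq mult.commute)
        qed simp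
        finally show "(\<integral>x. ?d x \<partial>M) \<le> real k powr (p - 1) * (C + C)" .
      qed (use assms(1) \<eta> D in auto)
      also have "\<eta> * (real k powr (p - 1) * (C + C)) = \<eta> * (2 * C) * real k powr (p - 1)" by simp
      finally have "(\<integral>x. \<bar>S (Suc k) x\<bar> powr p \<partial>M)
        \<le> (\<integral>x. \<bar>S k x\<bar> powr p \<partial>M) + B + \<eta> * (2 * C) * real k powr (p - 1)" by (simp add: B_def)
      moreover have "\<eta> * (2 * C) * real k powr (p - 1) \<le> e * real k powr (p - 1)"
        using \<eta>(2) by (intro mult_right_mono) auto
      ultimately show ?thesis by linarith
    qed
    have growth: "(\<integral>x. \<bar>S k x\<bar> powr p \<partial>M) \<le> B * real k + e * real k powr p" for k
    proof (induction k)
      case 0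
      show ?case by (simp add: S_def)
    next
      case (Suc k)
      have "real k powr p + real k powr (p - 1) = (real k + 1) * real k powr (p - 1)"
        using powr_add[of "real k" 1 "p - 1"] by (cases "k = 0") (auto simp: algebra_simps)
      also have "\<dots> \<le> (real k + 1) * (real k + 1) powr (p - 1)"
        using assms(1) by (intro mult_left_mono powr_mono2) auto
      also have "\<dots> = real (Suc k) powr p"
        using powr_add[of "real k + 1" 1 "p - 1"] by (simp add: add.commute)
      finally have "e * (real k powr p + real k powr (p - 1)) \<le> e * real (Suc k) powr p"
        using \<open>0 < e\<close> by (intro mult_left_mono) auto
      then have "e * real k powr p + e * real k powr (p - 1) \<le> e * real (Suc k) powr p"
        by (simp only: distrib_left)
      moreover have "B * real (Suc k) = B * real k + B" by (simp add: algebra_simps)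
      ultimately show ?case using Suc step[of k] by linarith
    qed
    have "(\<integral>x. \<bar>S k x\<bar> powr p \<partial>M) / real k powr p \<le> B * real k powr (1 - p) + e" if "1 \<le> k" for k
    proof -
      have "(\<integral>x. \<bar>S k x\<bar> powr p \<partial>M) / real k powr p \<le> (B * real k + e * real k powr p) / real k powr p"
        by (intro divide_right_mono growth) auto
      also have "\<dots> = B * real k powr (1 - p) + e"
        using that powr_diff[of "real k" 1 p] by (simp add: add_divide_distrib)
      finally show ?thesis .
    qed
    then show "\<exists>A. eventually (\<lambda>k. (\<integral>x. \<bar>\<Sum>r<k. w (s r) x\<bar> powr p \<partial>M) / real k powr p
        \<le> A * real k powr (1 - p) + e) sequentially"
      unfolding eventually_sequentially S_def by blast
  qed
  ultimately show ?thesis by (intro exI[of _ Q]) blast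
qed

section \<open>Vector-valued functions on Euclidean space\<close>

lemma Lp_scale:
  assumes "f \<in> Lp p"
  shows "(\<lambda>x. c * f x) \<in> Lp p"
  using assms by (auto simp: Lp_def abs_mult powr_mult)

lemma Lp_add:
  assumes "1 \<le> p" "f \<in> Lp p" "g \<in> Lp p"
  shows "(\<lambda>x. f x + g x) \<in> Lp p"
proof -
  have [measurable]: "f \<in> borel_measurable lebesgue" "g \<in> borel_measurable lebesgue"
    and int: "integrable lebesgue (\<lambda>x. \<bar>f x\<bar> powr p)" "integrable lebesgue (\<lambda>x. \<bar>g x\<bar> powr p)"
    using assms by (auto simp: Lp_def)
  have "integrable lebesgue (\<lambda>x. \<bar>f x + g x\<bar> powr p)"
  proof (rule Bochner_Integration.integrable_bound)
    show "integrable lebesgue (\<lambda>x. 2 powr p * (\<bar>f x\<bar> powr p + \<bar>g x\<bar> powr p))" using int by simp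
    have "\<bar>f x + g x\<bar> powr p \<le> 2 powr p * (\<bar>f x\<bar> powr p + \<bar>g x\<bar> powr p)" for x
    proof -
      have "\<bar>f x + g x\<bar> powr p \<le> (2 * max \<bar>f x\<bar> \<bar>g x\<bar>) powr p"
        using assms(1) by (intro powr_mono2) auto
      also have "\<dots> = 2 powr p * max \<bar>f x\<bar> \<bar>g x\<bar> powr p"
        by (rule powr_mult)
      also have "\<dots> \<le> 2 powr p * (\<bar>f x\<bar> powr p + \<bar>g x\<bar> powr p)"
        by (intro mult_left_mono) (auto simp: max_def)
      finally show ?thesis .
    qed
    then show "AE x in lebesgue. norm (\<bar>f x + g x\<bar> powr p)
        \<le> norm (2 powr p * (\<bar>f x\<bar> powr p + \<bar>g x\<bar> powr p))" by (simp add: abs_mult)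
  qed measurable
  then show "(\<lambda>x. f x + g x) \<in> Lp p" by (simp add: Lp_def)
qed

lemma Lp_sum:
  assumes "1 \<le> p" "\<And>r. f r \<in> Lp p"
  shows "(\<lambda>x. \<Sum>r<(k::nat). f r x) \<in> Lp p"
proof (induction k)
  case 0
  show ?case by (simp add: Lp_def)
next
  case (Suc k)
  from Lp_add[OF assms(1) this assms(2)[of k]] show ?case by simp
qed

lemma Lp_diff:
  assumes "1 \<le> p" "f \<in> Lp p" "g \<in> Lp p"
  shows "(\<lambda>x. f x - g x) \<in> Lp p"
  using Lp_add[OF assms(1,2) Lp_scale[OF assms(3), of "-1"]] by simp

text \<open>The two cases combined. Test functions bounded by \<open>1\<close> everywhere are enough when \<open>p = 1\<close>; the weight
\<open>h\<close> exists because Lebesgue measure is sigma-finite.\<close>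

lemma weakly_convergent_cesaro_selection:
  fixes f :: "nat \<Rightarrow> real ^ 'n \<Rightarrow> real"
  assumes "1 \<le> p" and conv: "weakly_convergent_Lp p f g"
  shows "\<exists>Q. (\<forall>l. eventually (Q l) sequentially) \<and>
    (\<forall>s. (\<forall>k. Q (map s [0..<k]) (s k)) \<longrightarrow>
      (\<lambda>k. (\<integral>x. \<bar>\<Sum>r<k. f (s r) x - g x\<bar> powr p \<partial>lebesgue) / real k powr p) \<longlonglongrightarrow> 0)"
proof -
  have Lp: "f i \<in> Lp p" "g \<in> Lp p" for i using conv by (auto simp: weakly_convergent_Lp_def)
  then have [measurable]: "f i \<in> borel_measurable lebesgue" "g \<in> borel_measurable lebesgue"
    and int: "integrable lebesgue (\<lambda>x. \<bar>f i x\<bar> powr p)" "integrable lebesgue (\<lambda>x. \<bar>g x\<bar> powr p)" for i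
    by (auto simp: Lp_def)
  have diff: "integrable lebesgue (\<lambda>x. \<bar>f i x - g x\<bar> powr p)" for i
    using Lp_diff[OF assms(1) Lp] by (simp add: Lp_def)
  have lim: "(\<lambda>i. \<integral>x. (f i x - g x) * v x \<partial>lebesgue) \<longlonglongrightarrow> 0"
    if "v \<in> Lp_conj p" and int_v: "\<And>i. integrable lebesgue (\<lambda>x. f i x * v x)"
      "integrable lebesgue (\<lambda>x. g x * v x)" for v
  proof -
    have "(\<lambda>i. (\<integral>x. f i x * v x \<partial>lebesgue) - (\<integral>x. g x * v x \<partial>lebesgue)) \<longlonglongrightarrow> 0"
      using conv that(1) by (auto simp: weakly_convergent_Lp_def LIM_zero_iff)
    then show ?thesis using int_v by (simp add: left_diff_distrib)
  qed
  show ?thesis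
  proof (cases "p = 1")
    case True
    have intable: "integrable lebesgue (f i)" "integrable lebesgue g" for i
      using int True by (auto simp: integrable_abs_iff)
    have null: "L1_weakly_null lebesgue (\<lambda>i x. f i x - g x)"
      unfolding L1_weakly_null_def
    proof (intro conjI allI ballI impI)
      fix v :: "real ^ 'n \<Rightarrow> real"
      assume v: "v \<in> borel_measurable lebesgue" "\<forall>x. \<bar>v x\<bar> \<le> 1"
      show "(\<lambda>i. \<integral>x. (f i x - g x) * v x \<partial>lebesgue) \<longlonglongrightarrow> 0"
      proof (rule lim)
        show "v \<in> Lp_conj p" using v True by (auto simp: Lp_conj_def Linf_def)
      qed (use v intable in \<open>auto intro!: integrable_mult_bounded[where B=1]\<close>)
    qed (use intable in auto)
    obtain h :: "real ^ 'n \<Rightarrow> real" where h: "h \<in> borel_measurable lborel" "\<And>x. 0 < h x"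
      "\<And>x. h x \<le> 1" "integrable lborel h"
      using sigma_finite_measure.obtain_positive_integrable_function[OF sigma_finite_lborel] by blast
    then have "integrable lebesgue h" by (simp add: integrable_completion)
    from L1_cesaro_selection[OF null this h(2)] show ?thesis by (simp add: True)
  next
    case False
    with assms(1) have "1 < p" by simp
    have "Lp_weakly_null lebesgue p (\<lambda>i x. f i x - g x)"
      unfolding Lp_weakly_null_def
    proof (intro conjI allI ballI impI diff)
      fix v :: "real ^ 'n \<Rightarrow> real"
      assume v: "v \<in> borel_measurable lebesgue" "integrable lebesgue (\<lambda>x. \<bar>v x\<bar> powr (p / (p - 1)))"
      show "(\<lambda>i. \<integral>x. (f i x - g x) * v x \<partial>lebesgue) \<longlonglongrightarrow> 0"
      proof (rule lim)
        show "v \<in> Lp_conj p" using v False by (auto simp: Lp_conj_def Lp_def)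
      qed (use v int in \<open>auto intro!: integrable_mult_conjugate[OF \<open>1 < p\<close>]\<close>)
    qed measurable
    from Lp_cesaro_selection[OF \<open>1 < p\<close> this] show ?thesis .
  qed
qed

theorem theorem1:
  fixes p :: real
    and u :: "nat \<Rightarrow> real ^ 'n \<Rightarrow> real ^ 'm"
    and v :: "real ^ 'n \<Rightarrow> real ^ 'm"
  assumes "1 \<le> p"
    and "weakly_convergent_Lp_vec p u v"
  shows "\<exists>s :: nat \<Rightarrow> nat. strict_mono s \<and>
    strongly_convergent_Lp_vec p (\<lambda>k x. (1 / real k) *\<^sub>R (\<Sum>r<k. u (s r) x)) v"
proof -
  have conv: "weakly_convergent_Lp p (\<lambda>i x. u i x $ j) (\<lambda>x. v x $ j)" for j
    using assms(2) by (simp add: weakly_convergent_Lp_vec_def)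
  then have Lp: "(\<lambda>x. u i x $ j) \<in> Lp p" "(\<lambda>x. v x $ j) \<in> Lp p" for i j
    by (auto simp: weakly_convergent_Lp_def)
  have "\<exists>Q. \<forall>j. (\<forall>l. eventually (Q j l) sequentially) \<and>
    (\<forall>s. (\<forall>k. Q j (map s [0..<k]) (s k)) \<longrightarrow>
      (\<lambda>k. (\<integral>x. \<bar>\<Sum>r<k. u (s r) x $ j - v x $ j\<bar> powr p \<partial>lebesgue) / real k powr p) \<longlonglongrightarrow> 0)"
    using weakly_convergent_cesaro_selection[OF assms(1) conv] by (intro choice) blast
  then obtain Q where Q: "\<And>j l. eventually (Q j l) sequentially"
    "\<And>j s. (\<And>k. Q j (map s [0..<k]) (s k)) \<Longrightarrow>
      (\<lambda>k. (\<integral>x. \<bar>\<Sum>r<k. u (s r) x $ j - v x $ j\<bar> powr p \<partial>lebesgue) / real k powr p) \<longlonglongrightarrow> 0"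
    by blast
  have "eventually (\<lambda>n. \<forall>j. Q j l n) sequentially" for l
    using Q(1) by (rule eventually_all_finite)
  from ex_strict_mono_history[of "\<lambda>l n. \<forall>j. Q j l n", OF this] obtain s
    where s: "strict_mono s" "\<And>k j. Q j (map s [0..<k]) (s k)" by blast
  let ?m = "\<lambda>k x. (1 / real k) *\<^sub>R (\<Sum>r<k. u (s r) x)"
  have power_norm: "Lp_norm p (\<lambda>x. (?m k x - v x) $ j) powr p
      = (\<integral>x. \<bar>\<Sum>r<k. u (s r) x $ j - v x $ j\<bar> powr p \<partial>lebesgue) / real k powr p"
    if "0 < k" for k j
  proof -
    have "(?m k x - v x) $ j = (\<Sum>r<k. u (s r) x $ j - v x $ j) / real k" for x
      using that by (simp add: sum_subtractf field_simps)
    then show ?thesis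
      using assms(1) by (simp add: Lp_norm_def powr_powr powr_divide)
  qed
  have "(\<lambda>k. Lp_norm p (\<lambda>x. (?m k x - v x) $ j) powr p) \<longlonglongrightarrow> 0" for j
  proof (rule Lim_transform_eventually)
    show "(\<lambda>k. (\<integral>x. \<bar>\<Sum>r<k. u (s r) x $ j - v x $ j\<bar> powr p \<partial>lebesgue) / real k powr p) \<longlonglongrightarrow> 0"
      by (rule Q(2)) (rule s(2))
    show "eventually (\<lambda>k. (\<integral>x. \<bar>\<Sum>r<k. u (s r) x $ j - v x $ j\<bar> powr p \<partial>lebesgue) / real k powr p
        = Lp_norm p (\<lambda>x. (?m k x - v x) $ j) powr p) sequentially"
      using eventually_gt_at_top[of 0] by eventually_elim (simp only: power_norm)
  qed
  then have "(\<lambda>k. \<Sum>j\<in>UNIV. Lp_norm p (\<lambda>x. (?m k x - v x) $ j) powr p) \<longlonglongrightarrow> 0"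
    by (rule tendsto_null_sum)
  then have "(\<lambda>k. Lp_vec_norm p (\<lambda>x. ?m k x - v x)) \<longlonglongrightarrow> 0"
    unfolding Lp_vec_norm_def using assms(1)
    by (intro tendsto_zero_powrI[where b="1 / p"]) (auto intro!: always_eventually sum_nonneg)
  moreover have "?m k \<in> Lp_vec p" for k
  proof -
    have "(\<lambda>x. 1 / real k * (\<Sum>r<k. u (s r) x $ j)) \<in> Lp p" for j
      by (intro Lp_scale Lp_sum assms(1) Lp(1))
    then show ?thesis by (simp add: Lp_vec_def)
  qed
  moreover have "v \<in> Lp_vec p" using Lp(2) by (simp add: Lp_vec_def)
  ultimately show ?thesis using s(1) unfolding strongly_convergent_Lp_vec_def by blast
qed

end
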